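(* Consider the Sherrington–Kirkpatrick model at inverse temperature $\beta>0$. Let $(N_k)$ be a subsequence for which $(G_{N_k,\beta,J})_k$ converges to the metastate $\kappa_J$, in the sense that $\nu(dJ)\times\prod_{i\in\mathbb{N}}G_{N_k,\beta,J}$ converges, in the sense of finite-dimensional distributions on couplings and spins, to $\nu(dJ)\times\int\kappa_J(d\Gamma)\prod_{i\in\mathbb{N}}\Gamma$. Then the ROSt's $Q^{N_k}$ converge in law, as $k\to\infty$, to the ROSt $Q$, where $Q^N=\{q^N_{ij}\}$ is defined by $$\mathbb{E}\big[F(q^N_{ij}:1\le i<j\le s)\big]=\int\nu(dJ)\,G_{N,\beta,J}^{\times s}\Big(F(R^N(\sigma^i,\sigma^j):1\le i<j\le s)\Big)$$ and $Q=\{q_{ij}\}$ is defined by $$\mathbb{E}\big[F(q_{ij}:1\le i<j\le s)\big]=\int\nu(dJ)\int\kappa_J(d\Gamma)\,\Gamma^{\times s}\Big(F(R(\sigma^i,\sigma^j):1\le i<j\le s)\Big),$$ for all $s\in\mathbb{N}$ and all continuous real functions $F$.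
   Context: Let $J=\{J_{xy}:x\ne y;\ x,y\in\mathbb{N}\}$ be a family (indexed by unordered pairs) of i.i.d. mean-zero Gaussian variables with joint law $\nu$. The Sherrington–Kirkpatrick (SK) Hamiltonian on $\{-1,+1\}^N$ is $H_{N,J}(\sigma)=-\frac1{\sqrt N}\sum_{1\le x<y\le N}J_{xy}\sigma_x\sigma_y$, with Gibbs measure $G_{N,\beta,J}(\sigma)=e^{-\beta H_{N,J}(\sigma)}/Z_{N,J}(\beta)$, $Z_{N,J}(\beta)=\sum_\sigma e^{-\beta H_{N,J}(\sigma)}$. A metastate $\kappa_J$ is, for $\nu$-almost all $J$, a probability measure on the space of Borel probability measures $\Gamma$ on $\{-1,+1\}^{\mathbb{N}}$ (product topology) obtained from a subsequential limit $M=\nu(dJ)\int\kappa_J(d\Gamma)\prod_{i\in\mathbb{N}}\Gamma$ of the laws $\nu(dJ)\prod_{i\in\mathbb{N}}G_{N,\beta,J}$ of $(J,\{\sigma^i\}_{i\in\mathbb{N}})$; convergence is that of the joint laws of finitely many couplings and of the spins of finitely many replicas on finitely many sites, and the representation of the limit comes from exchangeability in $i$ and de Finetti's theorem. The spin overlap is $R^N(\sigma,\sigma')=\frac1N\sum_{x=1}^N\sigma_x\sigma'_x$, and $R(\sigma,\sigma')=\lim_{N\to\infty}R^N(\sigma,\sigma')$, a limit that exists $\Gamma\times\Gamma\,\kappa_J(d\Gamma)$-almost surely for $\nu$-almost all $J$. $\Gamma^{\times s}$ denotes the $s$-fold product measure. A Random Overlap Structure (ROSt) is a random $\mathbb{N}\times\mathbb{N}$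 covariance matrix $\{q_{ij}\}$ with $1$'s on the diagonal whose law is invariant under $q_{ij}\mapsto q_{\pi(i)\pi(j)}$ for every permutation $\pi$ of finitely many indices. Its law is a Borel probability measure on the positive semidefinite symmetric matrices with unit diagonal, a closed subset of $[-1,1]^{\mathbb{N}\times\mathbb{N}}$ with the product topology, and is determined by the expectations of continuous functions $F$ of $(q_{ij}:1\le i<j\le s)$, $s\in\mathbb{N}$; convergence in law is weak convergence of such measures. *)

theory Defs
  imports "HOL-Probability.Probability"
begin

text \<open>Sites and replicas are numbered from 0: the \<open>N\<close>-site system lives on the sites
  \<open>{..<N}\<close>, and \<open>s\<close> replicas are indexed by \<open>{..<s}\<close>.\<close>

definition edges :: "nat set set" where
  "edges = {{x, y} | x y. x \<noteq> y}"

text \<open>The law \<open>\<nu>\<close> of the couplings; \<open>sd\<close> is the common standard deviation.\<close>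

definition coupling_law :: "real \<Rightarrow> (nat set \<Rightarrow> real) measure" where
  "coupling_law sd = (\<Pi>\<^sub>M e\<in>edges. density lborel (normal_density 0 sd))"

definition hamiltonian :: "nat \<Rightarrow> (nat set \<Rightarrow> real) \<Rightarrow> (nat \<Rightarrow> real) \<Rightarrow> real" where
  "hamiltonian N J \<sigma> = - (1 / sqrt (real N)) * (\<Sum>y<N. \<Sum>x<y. J {x, y} * \<sigma> x * \<sigma> y)"

definition configs :: "nat \<Rightarrow> (nat \<Rightarrow> real) set" where
  "configs N = {..<N} \<rightarrow>\<^sub>E {-1, 1}"

definition partition_function :: "real \<Rightarrow> nat \<Rightarrow> (nat set \<Rightarrow> real) \<Rightarrow> real" where
  "partition_function \<beta> N J = (\<Sum>\<sigma>\<in>configs N. exp (- \<beta> * hamiltonian N J \<sigma>))"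

definition gibbs :: "real \<Rightarrow> nat \<Rightarrow> (nat set \<Rightarrow> real) \<Rightarrow> (nat \<Rightarrow> real) measure" where
  "gibbs \<beta> N J = point_measure (configs N)
     (\<lambda>\<sigma>. ennreal (exp (- \<beta> * hamiltonian N J \<sigma>) / partition_function \<beta> N J))"

text \<open>\<open>{-1,+1}\<^sup>\<nat>\<close>; its product sigma-algebra is the Borel sigma-algebra of the product topology.\<close>

definition spin_space :: "(nat \<Rightarrow> real) measure" where
  "spin_space = (\<Pi>\<^sub>M x\<in>UNIV. count_space {-1, 1})"

text \<open>Expectations under \<open>\<nu>(dJ) \<Prod>\<^bsub>i\<in>I\<^esub> G\<^bsub>N,\<beta>,J\<^esub>\<close> and
  \<open>\<nu>(dJ) \<integral>\<kappa>\<^sub>J(d\<Gamma>) \<Prod>\<^bsub>i\<in>I\<^esub> \<Gamma>\<close>, where \<open>I\<close> is the index set of the replicas.\<close>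

definition gibbs_mean ::
  "real \<Rightarrow> real \<Rightarrow> nat \<Rightarrow> nat set \<Rightarrow> ((nat set \<Rightarrow> real) \<Rightarrow> (nat \<Rightarrow> nat \<Rightarrow> real) \<Rightarrow> real) \<Rightarrow> real" where
  "gibbs_mean sd \<beta> N I f =
     (\<integral>J. (\<integral>\<sigma>. f J \<sigma> \<partial>(\<Pi>\<^sub>M i\<in>I. gibbs \<beta> N J)) \<partial>coupling_law sd)"

definition metastate_mean ::
  "real \<Rightarrow> ((nat set \<Rightarrow> real) \<Rightarrow> (nat \<Rightarrow> real) measure measure) \<Rightarrow> nat set \<Rightarrow>
   ((nat set \<Rightarrow> real) \<Rightarrow> (nat \<Rightarrow> nat \<Rightarrow> real) \<Rightarrow> real) \<Rightarrow> real" where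
  "metastate_mean sd \<kappa> I f =
     (\<integral>J. (\<integral>\<Gamma>. (\<integral>\<sigma>. f J \<sigma> \<partial>(\<Pi>\<^sub>M i\<in>I. \<Gamma>)) \<partial>\<kappa> J) \<partial>coupling_law sd)"

text \<open>Weak convergence of the joint laws of the couplings in \<open>A\<close> and of the spins of the replicas
  in \<open>I\<close> at the sites in \<open>L\<close>. Only those \<open>k\<close> with \<open>L \<subseteq> {..<N k}\<close> are meaningful, which is all
  but finitely many.\<close>

definition fdd_topology ::
  "nat set set \<Rightarrow> nat set \<Rightarrow> nat set \<Rightarrow> ((nat set \<Rightarrow> real) \<times> (nat \<times> nat \<Rightarrow> real)) topology" where
  "fdd_topology A I L = prod_topology (product_topology (\<lambda>_. euclideanreal) A)
     (product_topology (\<lambda>_. discrete_topology {-1, 1}) (I \<times> L))"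

definition fdd_convergence ::
  "real \<Rightarrow> real \<Rightarrow> (nat \<Rightarrow> nat) \<Rightarrow> ((nat set \<Rightarrow> real) \<Rightarrow> (nat \<Rightarrow> real) measure measure) \<Rightarrow> bool" where
  "fdd_convergence sd \<beta> N \<kappa> \<longleftrightarrow>
     (\<forall>A I L f. finite A \<and> A \<subseteq> edges \<and> finite I \<and> finite L \<and>
        continuous_map (fdd_topology A I L) euclideanreal f \<and>
        bounded (f ` topspace (fdd_topology A I L)) \<longrightarrow>
        (\<lambda>k. gibbs_mean sd \<beta> (N k) UNIV
               (\<lambda>J \<sigma>. f (restrict J A, restrict (\<lambda>(i, x). \<sigma> i x) (I \<times> L))))
        \<longlonglongrightarrow> metastate_mean sd \<kappa> UNIV
               (\<lambda>J \<sigma>. f (restrict J A, restrict (\<lambda>(i, x). \<sigma> i x) (I \<times> L))))"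

definition fin_overlap :: "nat \<Rightarrow> (nat \<Rightarrow> real) \<Rightarrow> (nat \<Rightarrow> real) \<Rightarrow> real" where
  "fin_overlap N \<sigma> \<sigma>' = (\<Sum>x<N. \<sigma> x * \<sigma>' x) / real N"

definition overlap :: "(nat \<Rightarrow> real) \<Rightarrow> (nat \<Rightarrow> real) \<Rightarrow> real" where
  "overlap \<sigma> \<sigma>' = lim (\<lambda>N. fin_overlap N \<sigma> \<sigma>')"

definition cov_matrices :: "(nat \<Rightarrow> nat \<Rightarrow> real) set" where
  "cov_matrices = {q. (\<forall>i. q i i = 1) \<and> (\<forall>i j. q i j = q j i) \<and>
     (\<forall>n c. 0 \<le> (\<Sum>i<n. \<Sum>j<n. c i * c j * q i j))}"

text \<open>A random overlap structure is represented by its law.\<close>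

definition ROSt :: "(nat \<Rightarrow> nat \<Rightarrow> real) measure \<Rightarrow> bool" where
  "ROSt Q \<longleftrightarrow> prob_space Q \<and> sets Q = sets (restrict_space borel cov_matrices) \<and>
     (\<forall>\<pi>. bij \<pi> \<and> finite {i. \<pi> i \<noteq> i} \<longrightarrow> distr Q Q (\<lambda>q i j. q (\<pi> i) (\<pi> j)) = Q)"

definition converges_in_law ::
  "(nat \<Rightarrow> (nat \<Rightarrow> nat \<Rightarrow> real) measure) \<Rightarrow> (nat \<Rightarrow> nat \<Rightarrow> real) measure \<Rightarrow> bool" where
  "converges_in_law Qs Q \<longleftrightarrow>
     (\<forall>f :: (nat \<Rightarrow> nat \<Rightarrow> real) \<Rightarrow> real.
        continuous_on cov_matrices f \<and> bounded (f ` cov_matrices) \<longrightarrow>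
        (\<lambda>k. \<integral>q. f q \<partial>Qs k) \<longlonglongrightarrow> (\<integral>q. f q \<partial>Q))"

definition upper :: "nat \<Rightarrow> (nat \<Rightarrow> nat \<Rightarrow> real) \<Rightarrow> nat \<times> nat \<Rightarrow> real" where
  "upper s q = restrict (\<lambda>(i, j). q i j) {(i, j). i < j \<and> j < s}"

text \<open>The functions \<open>F\<close> are continuous on all of \<open>\<real>\<^bsup>s(s-1)/2\<^esup>\<close>; by the Tietze extension
  theorem their restrictions to the cube \<open>[-1,1]\<^bsup>s(s-1)/2\<^esup>\<close>, which carries all the laws below,
  are exactly the continuous functions on that cube.\<close>

definition cylinder_fun :: "nat \<Rightarrow> ((nat \<times> nat \<Rightarrow> real) \<Rightarrow> real) \<Rightarrow> bool" where
  "cylinder_fun s F \<longleftrightarrow>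
     continuous_map (product_topology (\<lambda>_. euclideanreal) {(i, j). i < j \<and> j < s}) euclideanreal F"

definition is_gibbs_ROSt :: "real \<Rightarrow> real \<Rightarrow> nat \<Rightarrow> (nat \<Rightarrow> nat \<Rightarrow> real) measure \<Rightarrow> bool" where
  "is_gibbs_ROSt sd \<beta> N Q \<longleftrightarrow> ROSt Q \<and>
     (\<forall>s F. cylinder_fun s F \<longrightarrow>
        (\<integral>q. F (upper s q) \<partial>Q) =
        gibbs_mean sd \<beta> N {..<s} (\<lambda>J \<sigma>. F (upper s (\<lambda>i j. fin_overlap N (\<sigma> i) (\<sigma> j)))))"

definition is_metastate_ROSt ::
  "real \<Rightarrow> ((nat set \<Rightarrow> real) \<Rightarrow> (nat \<Rightarrow> real) measure measure) \<Rightarrow>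
   (nat \<Rightarrow> nat \<Rightarrow> real) measure \<Rightarrow> bool" where
  "is_metastate_ROSt sd \<kappa> Q \<longleftrightarrow> ROSt Q \<and>
     (\<forall>s F. cylinder_fun s F \<longrightarrow>
        (\<integral>q. F (upper s q) \<partial>Q) =
        metastate_mean sd \<kappa> {..<s} (\<lambda>J \<sigma>. F (upper s (\<lambda>i j. overlap (\<sigma> i) (\<sigma> j)))))"

end

theory Submission
  imports Defs
begin

text \<open>
  The proof is by the method of moments. Covariance matrices with unit diagonal form a compact space,
  so by the Stone--Weierstrass theorem the laws on it and their weak convergence are determined by the
  expectations of monomials in the entries above the diagonal (\<open>converges_in_lawI_moments\<close>,
  \<open>ROSt_eqI_moments\<close>); monomials are cylinder functions (\<open>monomial_cylinder\<close>). This gives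
  uniqueness of both structures and reduces the convergence to that of monomials.

  Under \<open>\<nu>(dJ) \<Prod> G\<^sub>N\<close> the sites are exchangeable, because the couplings are identically distributed
  and independent (\<open>gibbs_mean_permute\<close>). Expand a monomial \<open>R(\<sigma>\<^sup>i,\<sigma>\<^sup>j) \<cdots>\<close> with \<open>m\<close> factors, each an
  average over the first \<open>n \<le> N\<close> sites, into spin correlations. Up to an error \<open>O(m\<^sup>2 / n)\<close> uniform in
  \<open>N\<close> only terms with distinct sites matter, and by exchangeability all these are equal to the
  correlation in which the \<open>e\<close>-th factor uses the site \<open>e\<close>; the factors are treated one by one
  (\<open>prod_averages_decouple\<close>, \<open>gibbs_moment_decouple\<close>). This correlation involves only finitely many
  spins, so it converges along \<open>N k\<close> by hypothesis (\<open>spin_moment_limit\<close>). With \<open>n = N k\<close> one obtains the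
  limit of the moments of the finite overlaps. With \<open>n\<close> fixed the estimate carries over to the
  metastate (\<open>metastate_moment_decouple\<close>), and letting \<open>n\<close> tend to infinity identifies the moments of the
  limiting overlaps with the same correlation (\<open>metastate_overlap_moment\<close>).

  That the overlaps exist almost surely under the metastate also follows from exchangeability: the
  signs \<open>\<sigma>\<^sup>i\<^sub>x \<sigma>\<^sup>j\<^sub>x\<close> have pair correlations that do not depend on the two sites, hence obey a law of large
  numbers (\<open>averages_converge_AE\<close>). So the matrix of overlaps of infinitely many replicas is almost
  surely a covariance matrix, and its law, like that of the matrix of finite overlaps, is a random
  overlap structure (\<open>ROSt_overlap_law\<close>).
\<close>

section \<open>The compact space of overlap matrices\<close>

lemma cov_matrices_abs_le_1:
  assumes "q \<in> cov_matrices"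
  shows "\<bar>q i j\<bar> \<le> 1"
proof (cases "i = j")
  case True
  then show ?thesis using assms by (simp add: cov_matrices_def)
next
  case False
  have sym: "q j i = q i j" and diag: "q i i = 1" "q j j = 1"
    using assms by (auto simp: cov_matrices_def)
  have psd: "0 \<le> (\<Sum>a<n. \<Sum>b<n. c a * c b * q a b)" for n c
    using assms by (auto simp: cov_matrices_def)
  \<comment> \<open>positivity on the vectors \<open>e\<^sub>i + t e\<^sub>j\<close> with \<open>t = 1\<close> and \<open>t = -1\<close>\<close>
  have "0 \<le> 2 + 2 * t * q i j" if t: "t * t = 1" for t :: real
  proof -
    define n where "n = Suc (max i j)"
    define c where "c a = (if a = i then 1 else if a = j then t else 0)" for a
    have supp: "(\<Sum>a<n. c a * g a) = g i + t * g j" for g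
    proof -
      have "(\<Sum>a<n. c a * g a) = (\<Sum>a\<in>{i, j}. c a * g a)"
        by (rule sum.mono_neutral_right) (auto simp: n_def c_def)
      also have "\<dots> = g i + t * g j"
        using False by (simp add: c_def)
      finally show ?thesis .
    qed
    have "(\<Sum>a<n. \<Sum>b<n. c a * c b * q a b) = (\<Sum>a<n. c a * (\<Sum>b<n. c b * q a b))"
      by (simp add: sum_distrib_left mult.assoc)
    also have "\<dots> = 2 + 2 * t * q i j"
      unfolding supp using t by (simp add: sym diag algebra_simps)
    finally show ?thesis using psd[where n = n and c = c] by simp
  qed
  from this[of 1] this[of "-1"] show ?thesis by simp
qed

lemma continuous_on_entry [continuous_intros]:
  "continuous_on S (\<lambda>q :: nat \<Rightarrow> nat \<Rightarrow> real. q i j)"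
proof -
  have "continuous_on UNIV (\<lambda>q :: nat \<Rightarrow> nat \<Rightarrow> real. q i)"
    by (rule continuous_on_product_coordinates)
  from continuous_on_product_then_coordinatewise[OF this] show ?thesis
    by (rule continuous_on_subset) simp
qed

lemma closed_cov_matrices: "closed cov_matrices"
proof -
  have *: "cov_matrices = (\<Inter>i. {q. q i i = 1}) \<inter> (\<Inter>i. \<Inter>j. {q. q i j = q j i}) \<inter>
      (\<Inter>n. \<Inter>c. {q. 0 \<le> (\<Sum>i<n. \<Sum>j<n. c i * c j * q i j)})"
    unfolding cov_matrices_def by auto
  show ?thesis
    unfolding *
    by (intro closed_Int closed_INT ballI closed_Collect_eq closed_Collect_le continuous_on_sum
        continuous_on_mult continuous_on_const continuous_on_entry)
qed

lemma compact_box: "compact {q :: nat \<Rightarrow> nat \<Rightarrow> real. \<forall>i j. \<bar>q i j\<bar> \<le> B}"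
proof -
  have row: "compactin euclidean (PiE UNIV (\<lambda>_::nat. {-B..B}))"
    unfolding euclidean_product_topology[symmetric] compactin_PiE by simp
  have "compactin euclidean (PiE UNIV (\<lambda>_::nat. PiE UNIV (\<lambda>_::nat. {-B..B})))"
    using row unfolding euclidean_product_topology[symmetric, where 'b = "nat \<Rightarrow> real"] compactin_PiE
    by simp
  also have "PiE UNIV (\<lambda>_::nat. PiE UNIV (\<lambda>_::nat. {-B..B})) = {q. \<forall>i j. \<bar>q i j\<bar> \<le> B}"
  proof -
    have "x \<in> {-B..B} \<longleftrightarrow> \<bar>x\<bar> \<le> B" for x by auto
    then show ?thesis by (simp add: set_eq_iff PiE_iff del: atLeastAtMost_iff)
  qed
  finally show ?thesis by simp
qed

lemma compact_cov_matrices: "compact cov_matrices"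
proof -
  have "compact ({q. \<forall>i j. \<bar>q i j\<bar> \<le> 1} \<inter> cov_matrices)"
    by (intro compact_Int_closed compact_box closed_cov_matrices)
  also have "{q. \<forall>i j. \<bar>q i j\<bar> \<le> 1} \<inter> cov_matrices = cov_matrices"
    using cov_matrices_abs_le_1 by blast
  finally show ?thesis .
qed

text \<open>The map \<open>\<pi>\<close> need not be injective: the coefficients of indices with the same image add up.\<close>

lemma cov_matrices_reindex:
  assumes q: "q \<in> cov_matrices"
  shows "(\<lambda>i j. q (\<pi> i) (\<pi> j)) \<in> cov_matrices"
proof -
  have "0 \<le> (\<Sum>i<n. \<Sum>j<n. c i * c j * q (\<pi> i) (\<pi> j))" for n and c :: "nat \<Rightarrow> real"
  proof -
    define m where "m = Suc (Max (insert 0 (\<pi> ` {..<n})))"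
    have m: "\<pi> ` {..<n} \<subseteq> {..<m}"
      unfolding m_def by (auto simp: less_Suc_eq_le)
    define d where "d a = (\<Sum>i\<in>{i \<in> {..<n}. \<pi> i = a}. c i)" for a
    have group: "(\<Sum>i<n. c i * h (\<pi> i)) = (\<Sum>a<m. d a * h a)" for h
    proof -
      have "(\<Sum>i<n. c i * h (\<pi> i)) = (\<Sum>a<m. \<Sum>i\<in>{i \<in> {..<n}. \<pi> i = a}. c i * h (\<pi> i))"
        using m by (intro sum.group[symmetric]) auto
      also have "\<dots> = (\<Sum>a<m. d a * h a)"
        unfolding d_def sum_distrib_right by (intro sum.cong) auto
      finally show ?thesis .
    qed
    have "(\<Sum>i<n. \<Sum>j<n. c i * c j * q (\<pi> i) (\<pi> j)) = (\<Sum>i<n. c i * (\<Sum>j<n. c j * q (\<pi> i) (\<pi> j)))"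
      by (simp add: sum_distrib_left mult.assoc)
    also have "\<dots> = (\<Sum>a<m. \<Sum>b<m. d a * d b * q a b)"
      unfolding group group[of "\<lambda>a. \<Sum>b<m. d b * q a b"]
      by (simp add: sum_distrib_left mult.assoc)
    also have "\<dots> \<ge> 0"
      using q by (auto simp: cov_matrices_def)
    finally show ?thesis .
  qed
  with q show ?thesis
    by (auto simp: cov_matrices_def)
qed

section \<open>Moments determine the law and its limits\<close>

text \<open>Polynomials in the entries above the diagonal. A monomial is given by the list of its factors,
  each of which is the pair of indices of an entry.\<close>

inductive_set overlap_polys :: "((nat \<Rightarrow> nat \<Rightarrow> real) \<Rightarrow> real) set" where
  monomial: "\<forall>(i, j)\<in>set l. i < j \<Longrightarrow> (\<lambda>q. c * (\<Prod>(i, j)\<leftarrow>l. q i j)) \<in> overlap_polys"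
| add: "f \<in> overlap_polys \<Longrightarrow> g \<in> overlap_polys \<Longrightarrow> (\<lambda>q. f q + g q) \<in> overlap_polys"

lemma continuous_on_monomial:
  "continuous_on S (\<lambda>q :: nat \<Rightarrow> nat \<Rightarrow> real. \<Prod>(i, j)\<leftarrow>l. q i j)"
  by (induction l) (auto intro!: continuous_intros simp: case_prod_beta)

lemma continuous_on_overlap_poly:
  "f \<in> overlap_polys \<Longrightarrow> continuous_on S f"
  by (induction rule: overlap_polys.induct) (auto intro!: continuous_intros continuous_on_monomial)

lemma overlap_polys_mult:
  assumes "f \<in> overlap_polys" "g \<in> overlap_polys"
  shows "(\<lambda>q. f q * g q) \<in> overlap_polys"
  using assms(1)
proof (induction rule: overlap_polys.induct)
  case (monomial l c)
  from assms(2) show ?case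
  proof (induction rule: overlap_polys.induct)
    case (monomial l' c')
    have "(\<lambda>q. (c * c') * (\<Prod>(i, j)\<leftarrow>l @ l'. q i j)) \<in> overlap_polys"
      by (rule overlap_polys.monomial) (use monomial \<open>\<forall>(i, j)\<in>set l. i < j\<close> in auto)
    then show ?case by (simp add: ac_simps)
  next
    case (add f g)
    then show ?case by (auto simp: distrib_left intro: overlap_polys.add)
  qed
next
  case (add f f')
  then show ?case by (auto simp: distrib_right intro: overlap_polys.add)
qed

lemma overlap_polys_function_ring: "function_ring_on overlap_polys cov_matrices"
proof
  show "compact cov_matrices" by (rule compact_cov_matrices)
  show "(\<lambda>_. c) \<in> overlap_polys" for c
    using overlap_polys.monomial[of "[]" c] by simp
  fix q r :: "nat \<Rightarrow> nat \<Rightarrow> real"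
  assume qr: "q \<in> cov_matrices" "r \<in> cov_matrices" "q \<noteq> r"
  then obtain i j where ne: "q i j \<noteq> r i j" by (auto simp: fun_eq_iff)
  have "\<exists>i j. i < j \<and> q i j \<noteq> r i j"
  proof (cases i j rule: linorder_cases)
    case greater
    with qr ne show ?thesis by (intro exI[of _ j] exI[of _ i]) (auto simp: cov_matrices_def)
  qed (use qr ne in \<open>auto simp: cov_matrices_def\<close>)
  then obtain i j where ij: "i < j" "q i j \<noteq> r i j" by blast
  show "\<exists>f\<in>overlap_polys. f q \<noteq> f r"
  proof
    show "q i j \<noteq> r i j" by (rule ij)
    show "(\<lambda>q. q i j) \<in> overlap_polys"
      using overlap_polys.monomial[of "[(i, j)]" 1] ij by simp
  qed
qed (auto intro: continuous_on_overlap_poly overlap_polys_mult overlap_polys.add)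

lemma ROSt_space: "ROSt P \<Longrightarrow> space P = cov_matrices"
  using sets_eq_imp_space_eq[of P "restrict_space borel cov_matrices"]
  by (simp add: ROSt_def space_restrict_space)

lemma ROSt_measurable_continuous:
  assumes "ROSt P" "continuous_on cov_matrices f"
  shows "f \<in> borel_measurable P"
  using borel_measurable_continuous_on_restrict[OF assms(2)] assms(1)
  by (simp add: ROSt_def cong: measurable_cong_sets)

lemma ROSt_integrable_continuous:
  fixes f :: "(nat \<Rightarrow> nat \<Rightarrow> real) \<Rightarrow> real"
  assumes P: "ROSt P" and f: "continuous_on cov_matrices f"
  shows "integrable P f"
proof -
  interpret prob_space P using P by (simp add: ROSt_def)
  obtain B where B: "\<And>q. q \<in> cov_matrices \<Longrightarrow> norm (f q) \<le> B"
    using compact_imp_bounded[OF compact_continuous_image[OF f compact_cov_matrices]]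
    by (auto simp: bounded_iff)
  show ?thesis
    by (rule integrable_const_bound[of _ B])
      (use B ROSt_space[OF P] ROSt_measurable_continuous[OF P f] in auto)
qed

text \<open>By the Stone--Weierstrass theorem the moments of the entries above the diagonal
  control the expectations of all continuous functions.\<close>

lemma converges_in_lawI_moments:
  assumes Qs: "\<And>k. ROSt (Qs k)" and Q: "ROSt Q"
    and moments: "\<And>l. \<forall>(i, j)\<in>set l. i < j \<Longrightarrow>
      (\<lambda>k. \<integral>q. (\<Prod>(i, j)\<leftarrow>l. q i j) \<partial>Qs k) \<longlonglongrightarrow> (\<integral>q. (\<Prod>(i, j)\<leftarrow>l. q i j) \<partial>Q)"
  shows "converges_in_law Qs Q"
  unfolding converges_in_law_def
proof safe
  fix f :: "(nat \<Rightarrow> nat \<Rightarrow> real) \<Rightarrow> real"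
  assume f: "continuous_on cov_matrices f"
  have poly: "(\<lambda>k. \<integral>q. g q \<partial>Qs k) \<longlonglongrightarrow> (\<integral>q. g q \<partial>Q)" if "g \<in> overlap_polys" for g
    using that
  proof (induction rule: overlap_polys.induct)
    case (monomial l c)
    then show ?case by (auto intro!: tendsto_intros moments)
  next
    case (add g h)
    have "integrable P g" "integrable P h" if "ROSt P" for P
      using add(1,2) ROSt_integrable_continuous[OF that continuous_on_overlap_poly] by auto
    with add.IH Qs Q show ?case by (auto intro: tendsto_add)
  qed
  show "(\<lambda>k. \<integral>q. f q \<partial>Qs k) \<longlonglongrightarrow> (\<integral>q. f q \<partial>Q)"
  proof (rule LIMSEQ_I)
    fix r :: real assume r: "0 < r"
    obtain g where g: "g \<in> overlap_polys" "\<And>q. q \<in> cov_matrices \<Longrightarrow> \<bar>f q - g q\<bar> < r / 3"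
      using function_ring_on.Stone_Weierstrass_basic[OF overlap_polys_function_ring f, of "r / 3"] r
      by auto
    have close: "\<bar>(\<integral>q. f q \<partial>P) - (\<integral>q. g q \<partial>P)\<bar> \<le> r / 3" if P: "ROSt P" for P
    proof -
      interpret prob_space P using P by (simp add: ROSt_def)
      have int: "integrable P f" "integrable P g"
        using ROSt_integrable_continuous[OF P] f continuous_on_overlap_poly[OF g(1)] by auto
      have "\<bar>\<integral>q. f q - g q \<partial>P\<bar> \<le> (\<integral>q. \<bar>f q - g q\<bar> \<partial>P)"
        by (rule integral_abs_bound)
      also have "\<dots> \<le> (\<integral>q. r / 3 \<partial>P)"
        using int g(2) ROSt_space[OF P]
        by (intro integral_mono) (auto simp: less_imp_le)
      also have "\<dots> = r / 3" by (simp add: prob_space)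
      finally show ?thesis using int by simp
    qed
    obtain k0 where k0: "\<And>k. k \<ge> k0 \<Longrightarrow> \<bar>(\<integral>q. g q \<partial>Qs k) - (\<integral>q. g q \<partial>Q)\<bar> < r / 3"
      using LIMSEQ_D[OF poly[OF g(1)], of "r / 3"] r by auto
    have "\<bar>(\<integral>q. f q \<partial>Qs k) - (\<integral>q. f q \<partial>Q)\<bar> < r" if "k \<ge> k0" for k
      using close[OF Qs[of k]] close[OF Q] k0[OF that] by linarith
    then show "\<exists>k0. \<forall>k\<ge>k0. norm ((\<integral>q. f q \<partial>Qs k) - (\<integral>q. f q \<partial>Q)) < r" by auto
  qed
qed

text \<open>The indicator of a closed set is the decreasing limit of continuous functions, so the
  integrals of continuous functions determine the law.\<close>

lemma ROSt_eqI_continuous: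
  assumes P: "ROSt P" and P': "ROSt P'"
    and eq: "\<And>f :: (nat \<Rightarrow> nat \<Rightarrow> real) \<Rightarrow> real. continuous_on UNIV f \<Longrightarrow> (\<integral>q. f q \<partial>P) = (\<integral>q. f q \<partial>P')"
  shows "P = P'"
proof -
  have sets: "sets P = sets (restrict_space borel cov_matrices)" "sets P' = sets (restrict_space borel cov_matrices)"
    using P P' by (auto simp: ROSt_def)
  have id_meas: "(\<lambda>q. q) \<in> R \<rightarrow>\<^sub>M borel" if "ROSt R" for R
    using ROSt_measurable_continuous[OF that, of "\<lambda>q. q"] by simp
  have closed: "measure P C' = measure P' C'"
    if C: "closed C" and C': "C' = C \<inter> cov_matrices" for C C' :: "(nat \<Rightarrow> nat \<Rightarrow> real) set"
  proof (cases "C = {}")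
    case False
    define f where "f n q = max 0 (1 - real n * infdist q C)" for n and q :: "nat \<Rightarrow> nat \<Rightarrow> real"
    have cont: "continuous_on S (f n)" for n S
      unfolding f_def by (intro continuous_intros)
    have ptw: "(\<lambda>n. f n q) \<longlonglongrightarrow> indicator C q" for q
    proof (cases "q \<in> C")
      case True
      then show ?thesis by (simp add: f_def)
    next
      case nC: False
      then have pos: "infdist q C > 0"
        using C False by (simp add: infdist_pos_not_in_closed)
      obtain n0 where n0: "real n0 * infdist q C > 1"
        using reals_Archimedean3[OF pos] by blast
      have "f n q = 0" if "n \<ge> n0" for n
      proof -
        have "real n0 * infdist q C \<le> real n * infdist q C"
          using that pos by (intro mult_right_mono) auto
        with n0 show ?thesis by (simp add: f_def)
      qed
      then have "\<forall>\<^sub>F n in sequentially. f n q = indicator C q"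
        using nC by (auto simp: eventually_sequentially)
      then show ?thesis by (rule tendsto_eventually)
    qed
    have lim: "(\<lambda>n. \<integral>q. f n q \<partial>R) \<longlonglongrightarrow> measure R C'" if R: "ROSt R" for R
    proof -
      interpret prob_space R using R by (simp add: ROSt_def)
      have "(\<lambda>n. \<integral>q. f n q \<partial>R) \<longlonglongrightarrow> (\<integral>q. indicator C q \<partial>R)"
      proof (rule integral_dominated_convergence[where w = "\<lambda>_. 1"])
        show "f n \<in> borel_measurable R" for n
          by (rule ROSt_measurable_continuous[OF R cont])
        show "AE q in R. norm (f n q) \<le> 1" for n
          by (rule AE_I2) (simp add: f_def infdist_nonneg)
        show "(\<lambda>q. indicator C q :: real) \<in> borel_measurable R"
          using measurable_compose[OF id_meas[OF R], of "indicator C" borel] C by simp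
      qed (use ptw in auto)
      also have "(\<integral>q. indicator C q \<partial>R) = measure R C'"
        using ROSt_space[OF R] C' by simp
      finally show ?thesis .
    qed
    show ?thesis
      using lim[OF P] lim[OF P'] eq[OF cont] by (simp add: LIMSEQ_unique)
  qed (simp add: C')
  have "distr P borel (\<lambda>q. q) = distr P' borel (\<lambda>q. q)"
  proof (rule measure_eqI_generator_eq[where \<Omega> = UNIV and E = "Collect closed" and A = "\<lambda>_. UNIV"])
    show "Int_stable (Collect (closed :: (nat \<Rightarrow> nat \<Rightarrow> real) set \<Rightarrow> bool))"
      by (auto simp: Int_stable_def)
    show "emeasure (distr P borel (\<lambda>q. q)) X = emeasure (distr P' borel (\<lambda>q. q)) X"
      if "X \<in> Collect closed" for X
    proof -
      interpret P: prob_space P using P by (simp add: ROSt_def)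
      interpret P': prob_space P' using P' by (simp add: ROSt_def)
      from that show ?thesis
        using closed[of X] ROSt_space[OF P] ROSt_space[OF P']
        by (simp add: emeasure_distr id_meas P P' P.emeasure_eq_measure P'.emeasure_eq_measure)
    qed
    interpret P: prob_space P using P by (simp add: ROSt_def)
    show "emeasure (distr P borel (\<lambda>q. q)) UNIV \<noteq> \<infinity>" for i :: nat
      by (simp add: emeasure_distr id_meas P)
  qed (auto simp: borel_eq_closed)
  show ?thesis
  proof (rule measure_eqI)
    fix A assume "A \<in> sets P"
    then have A: "A \<in> sets borel" "A \<subseteq> cov_matrices"
      using borel_closed[OF closed_cov_matrices] by (auto simp: sets sets_restrict_space_iff)
    have "emeasure R A = emeasure (distr R borel (\<lambda>q. q)) A" if "ROSt R" for R
      using A ROSt_space[OF that] by (simp add: emeasure_distr id_meas that Int_absorb2)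
    with P P' \<open>distr P borel (\<lambda>q. q) = distr P' borel (\<lambda>q. q)\<close> show "emeasure P A = emeasure P' A"
      by simp
  qed (simp add: sets)
qed

lemma ROSt_eqI_moments:
  assumes P: "ROSt P" and P': "ROSt P'"
    and moments: "\<And>l. \<forall>(i, j)\<in>set l. i < j \<Longrightarrow>
      (\<integral>q. (\<Prod>(i, j)\<leftarrow>l. q i j) \<partial>P) = (\<integral>q. (\<Prod>(i, j)\<leftarrow>l. q i j) \<partial>P')"
  shows "P = P'"
proof (rule ROSt_eqI_continuous[OF P P'])
  fix f :: "(nat \<Rightarrow> nat \<Rightarrow> real) \<Rightarrow> real" assume "continuous_on UNIV f"
  then have f: "continuous_on cov_matrices f" by (rule continuous_on_subset) simp
  moreover have "converges_in_law (\<lambda>_. P) P'"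
    by (rule converges_in_lawI_moments) (auto simp: P P' moments)
  ultimately have "(\<lambda>k::nat. \<integral>q. f q \<partial>P) \<longlonglongrightarrow> (\<integral>q. f q \<partial>P')"
    using compact_imp_bounded[OF compact_continuous_image[OF f compact_cov_matrices]]
    by (auto simp: converges_in_law_def)
  then show "(\<integral>q. f q \<partial>P) = (\<integral>q. f q \<partial>P')"
    by (simp add: LIMSEQ_const_iff)
qed

text \<open>Every monomial in the entries above the diagonal is a cylinder function.\<close>

lemma monomial_cylinder:
  assumes "\<forall>(i, j)\<in>set l. i < j"
  obtains s F where "cylinder_fun s F" "\<And>q. F (upper s q) = (\<Prod>(i, j)\<leftarrow>l. q i j)"
proof
  define s where "s = Suc (Max (insert 0 (snd ` set l)))"
  have s: "(i, j) \<in> set l \<Longrightarrow> i < j \<and> j < s" for i j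
    using assms by (force simp: s_def less_Suc_eq_le intro!: Max_ge)
  have *: "continuous_map (product_topology (\<lambda>_. euclideanreal) {(i, j). i < j \<and> j < s}) euclideanreal
      (\<lambda>u. \<Prod>p\<leftarrow>l'. u p)" if "set l' \<subseteq> set l" for l'
    using that s by (induction l') (auto intro!: continuous_intros continuous_map_product_projection)
  then show "cylinder_fun s (\<lambda>u. \<Prod>p\<leftarrow>l. u p)"
    by (simp add: cylinder_fun_def)
  show "(\<Prod>p\<leftarrow>l. upper s q p) = (\<Prod>(i, j)\<leftarrow>l. q i j)" for q
    using s by (auto simp: upper_def intro!: arg_cong[of _ _ prod_list] map_cong)
qed

lemma ROSt_eqI_cylinder:
  assumes P: "ROSt P" and P': "ROSt P'"
    and eq: "\<And>s F. cylinder_fun s F \<Longrightarrow> (\<integral>q. F (upper s q) \<partial>P) = (\<integral>q. F (upper s q) \<partial>P')"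
  shows "P = P'"
proof (rule ROSt_eqI_moments[OF P P'])
  fix l :: "(nat \<times> nat) list" assume "\<forall>(i, j)\<in>set l. i < j"
  then obtain s F where F: "cylinder_fun s F" "\<And>q. F (upper s q) = (\<Prod>(i, j)\<leftarrow>l. q i j)"
    by (rule monomial_cylinder) blast
  show "(\<integral>q. (\<Prod>(i, j)\<leftarrow>l. q i j) \<partial>P) = (\<integral>q. (\<Prod>(i, j)\<leftarrow>l. q i j) \<partial>P')"
    using eq[OF F(1)] unfolding F(2) .
qed

section \<open>Replicas of a random measure and the law of their overlaps\<close>

lemma integral_bind_bounded:
  fixes f :: "'b \<Rightarrow> real"
  assumes M: "prob_space M" and K: "K \<in> M \<rightarrow>\<^sub>M prob_algebra L"
    and f: "f \<in> borel_measurable L" and bound: "\<And>x. x \<in> space L \<Longrightarrow> \<bar>f x\<bar> \<le> B"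
  shows "(\<integral>x. f x \<partial>(M \<bind> K)) = (\<integral>y. (\<integral>x. f x \<partial>K y) \<partial>M)"
proof -
  interpret prob_space M by fact
  have K': "K \<in> M \<rightarrow>\<^sub>M subprob_algebra L"
    by (rule measurable_prob_algebraD[OF K])
  have "(\<integral>x. f x \<partial>(M \<bind> K)) = (\<integral>x. f x \<partial>(join (distr M (subprob_algebra L) K)))"
    by (simp add: bind_nonempty''[OF K' not_empty])
  also have "\<dots> = (\<integral>\<Gamma>. (\<integral>x. f x \<partial>\<Gamma>) \<partial>distr M (subprob_algebra L) K)"
  proof (rule integral_join[where N = L and B = B and B' = 1, OF f bound])
    show "finite_measure (distr M (subprob_algebra L) K)"
      by (intro finite_measure_distr K')
    show "AE \<Gamma> in distr M (subprob_algebra L) K. emeasure \<Gamma> (space \<Gamma>) \<le> ennreal 1"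
      by (rule AE_I2) (auto simp: space_subprob_algebra subprob_space.emeasure_space_le_1)
  qed auto
  also have "\<dots> = (\<integral>y. (\<integral>x. f x \<partial>K y) \<partial>M)"
    by (rule integral_distr[OF K' integral_measurable_subprob_algebra[OF f]])
  finally show ?thesis .
qed

lemma power_kernel_measurable:
  "(\<lambda>\<Gamma>. Pi\<^sub>M I (\<lambda>_. \<Gamma>)) \<in> prob_algebra X \<rightarrow>\<^sub>M prob_algebra (Pi\<^sub>M I (\<lambda>_. X))"
proof (rule measurable_prob_algebra_generated[OF sets_PiM Int_stable_prod_algebra prod_algebra_sets_into_space])
  fix \<Gamma> assume "\<Gamma> \<in> space (prob_algebra X)"
  then show "prob_space (Pi\<^sub>M I (\<lambda>_. \<Gamma>))" "sets (Pi\<^sub>M I (\<lambda>_. \<Gamma>)) = sets (Pi\<^sub>M I (\<lambda>_. X))"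
    by (auto simp: space_prob_algebra intro!: prob_space_PiM sets_PiM_cong)
next
  fix A assume "A \<in> prod_algebra I (\<lambda>_. X)"
  then obtain J E where A: "A = prod_emb I (\<lambda>_. X) J (\<Pi>\<^sub>E j\<in>J. E j)" and J: "finite J" "J \<subseteq> I"
    and E: "\<And>j. j \<in> J \<Longrightarrow> E j \<in> sets X"
    by (elim prod_algebraE) auto
  have "emeasure (Pi\<^sub>M I (\<lambda>_. \<Gamma>)) A = (\<Prod>j\<in>J. emeasure \<Gamma> (E j))" if "\<Gamma> \<in> space (prob_algebra X)" for \<Gamma>
  proof -
    have \<Gamma>: "prob_space \<Gamma>" "sets \<Gamma> = sets X" using that by (auto simp: space_prob_algebra)
    have "A = prod_emb I (\<lambda>_. \<Gamma>) J (\<Pi>\<^sub>E j\<in>J. E j)"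
      unfolding A prod_emb_def using sets_eq_imp_space_eq[OF \<Gamma>(2)] by simp
    with \<Gamma> J E show ?thesis by (simp add: emeasure_PiM_emb)
  qed
  moreover have "(\<lambda>\<Gamma>. \<Prod>j\<in>J. emeasure \<Gamma> (E j)) \<in> borel_measurable (prob_algebra X)"
    using E by (intro borel_measurable_prod_ennreal measurable_compose[OF
          measurable_prob_algebraD[OF measurable_ident_sets[OF refl]] measurable_emeasure_subprob_algebra])
  ultimately show "(\<lambda>\<Gamma>. emeasure (Pi\<^sub>M I (\<lambda>_. \<Gamma>)) A) \<in> borel_measurable (prob_algebra X)"
    by (simp cong: measurable_cong)
qed

text \<open>The law of infinitely many replicas, drawn independently from a measure that itself is drawn
  from \<open>\<mu>\<close>.\<close>

definition replicas :: "'a measure measure \<Rightarrow> (nat \<Rightarrow> 'a) measure" where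
  "replicas \<mu> = \<mu> \<bind> (\<lambda>\<Gamma>. Pi\<^sub>M UNIV (\<lambda>_. \<Gamma>))"

lemma
  assumes \<mu>: "\<mu> \<in> space (prob_algebra (prob_algebra X))"
  shows prob_space_replicas: "prob_space (replicas \<mu>)"
    and sets_replicas: "sets (replicas \<mu>) = sets (Pi\<^sub>M UNIV (\<lambda>_. X))"
    and space_replicas: "space (replicas \<mu>) = UNIV \<rightarrow>\<^sub>E space X"
proof -
  show "prob_space (replicas \<mu>)"
    unfolding replicas_def by (rule prob_space_bind'[OF \<mu> power_kernel_measurable])
  show *: "sets (replicas \<mu>) = sets (Pi\<^sub>M UNIV (\<lambda>_. X))"
    unfolding replicas_def by (rule sets_bind'[OF \<mu> power_kernel_measurable])
  show "space (replicas \<mu>) = UNIV \<rightarrow>\<^sub>E space X"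
    using sets_eq_imp_space_eq[OF *] by (simp add: space_PiM)
qed

lemma kernel_measurable_cong:
  assumes "\<mu> \<in> space (prob_algebra L)" shows "(f \<in> \<mu> \<rightarrow>\<^sub>M K) = (f \<in> L \<rightarrow>\<^sub>M K)"
  using assms by (intro arg_cong2[of _ _ _ _ "(\<in>)"] refl measurable_cong_sets) (auto simp: space_prob_algebra)

lemma integral_replicas:
  fixes f :: "(nat \<Rightarrow> 'a) \<Rightarrow> real"
  assumes \<mu>: "\<mu> \<in> space (prob_algebra (prob_algebra X))"
    and f: "f \<in> borel_measurable (Pi\<^sub>M UNIV (\<lambda>_. X))"
    and bound: "\<And>\<sigma>. \<sigma> \<in> UNIV \<rightarrow>\<^sub>E space X \<Longrightarrow> \<bar>f \<sigma>\<bar> \<le> B"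
  shows "(\<integral>\<sigma>. f \<sigma> \<partial>replicas \<mu>) = (\<integral>\<Gamma>. (\<integral>\<sigma>. f \<sigma> \<partial>Pi\<^sub>M UNIV (\<lambda>_. \<Gamma>)) \<partial>\<mu>)"
  unfolding replicas_def
  using \<mu> by (intro integral_bind_bounded[OF _ _ f bound])
    (auto simp: kernel_measurable_cong[OF \<mu>] power_kernel_measurable space_prob_algebra space_PiM)

lemma integral_power_restrict:
  fixes f :: "(nat \<Rightarrow> 'a) \<Rightarrow> real"
  assumes \<Gamma>: "\<Gamma> \<in> space (prob_algebra X)" and f: "f \<in> borel_measurable (Pi\<^sub>M I (\<lambda>_. X))"
  shows "(\<integral>\<sigma>. f \<sigma> \<partial>Pi\<^sub>M I (\<lambda>_. \<Gamma>)) = (\<integral>\<sigma>. f (restrict \<sigma> I) \<partial>Pi\<^sub>M UNIV (\<lambda>_. \<Gamma>))"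
proof -
  have s: "sets \<Gamma> = sets X" using \<Gamma> by (simp add: space_prob_algebra)
  have "distr (Pi\<^sub>M UNIV (\<lambda>_. \<Gamma>)) (Pi\<^sub>M I (\<lambda>_. \<Gamma>)) (\<lambda>\<sigma>. restrict \<sigma> I) = Pi\<^sub>M I (\<lambda>_. \<Gamma>)"
    using distr_PiM_reindex[of UNIV "\<lambda>_. \<Gamma>" "\<lambda>i. i" I] \<Gamma> by (simp add: space_prob_algebra)
  then have "(\<integral>\<sigma>. f \<sigma> \<partial>Pi\<^sub>M I (\<lambda>_. \<Gamma>))
      = (\<integral>\<sigma>. f \<sigma> \<partial>distr (Pi\<^sub>M UNIV (\<lambda>_. \<Gamma>)) (Pi\<^sub>M I (\<lambda>_. \<Gamma>)) (\<lambda>\<sigma>. restrict \<sigma> I))"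
    by simp
  also have "\<dots> = (\<integral>\<sigma>. f (restrict \<sigma> I) \<partial>Pi\<^sub>M UNIV (\<lambda>_. \<Gamma>))"
    using f by (intro integral_distr measurable_restrict_subset)
      (auto cong: measurable_cong_sets sets_PiM_cong simp: s)
  finally show ?thesis .
qed

lemma replicas_reindex:
  fixes \<pi> :: "nat \<Rightarrow> nat"
  assumes \<mu>: "\<mu> \<in> space (prob_algebra (prob_algebra X))" and \<pi>: "inj \<pi>"
  shows "distr (replicas \<mu>) (Pi\<^sub>M UNIV (\<lambda>_. X)) (\<lambda>\<sigma> i. \<sigma> (\<pi> i)) = replicas \<mu>"
proof -
  have "distr (replicas \<mu>) (Pi\<^sub>M UNIV (\<lambda>_. X)) (\<lambda>\<sigma> i. \<sigma> (\<pi> i))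
      = \<mu> \<bind> (\<lambda>\<Gamma>. distr (Pi\<^sub>M UNIV (\<lambda>_. \<Gamma>)) (Pi\<^sub>M UNIV (\<lambda>_. X)) (\<lambda>\<sigma> i. \<sigma> (\<pi> i)))"
    unfolding replicas_def
  proof (rule distr_bind)
    show "(\<lambda>\<Gamma>. Pi\<^sub>M UNIV (\<lambda>_. \<Gamma>)) \<in> \<mu> \<rightarrow>\<^sub>M subprob_algebra (Pi\<^sub>M UNIV (\<lambda>_. X))"
      by (intro measurable_prob_algebraD) (simp add: kernel_measurable_cong[OF \<mu>] power_kernel_measurable)
    show "space \<mu> \<noteq> {}"
      using \<mu> by (auto simp: space_prob_algebra dest: prob_space.not_empty)
    show "(\<lambda>\<sigma> i. \<sigma> (\<pi> i)) \<in> Pi\<^sub>M UNIV (\<lambda>_. X) \<rightarrow>\<^sub>M Pi\<^sub>M UNIV (\<lambda>_. X)"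
      by (rule measurable_PiM_single') (auto simp: space_PiM)
  qed
  also have "\<dots> = replicas \<mu>"
    unfolding replicas_def
  proof (rule bind_cong_All, intro ballI)
    fix \<Gamma> assume "\<Gamma> \<in> space \<mu>"
    then have \<Gamma>: "prob_space \<Gamma>" "sets \<Gamma> = sets X"
      using \<mu> by (auto simp: space_prob_algebra dest!: sets_eq_imp_space_eq)
    have "distr (Pi\<^sub>M UNIV (\<lambda>_. \<Gamma>)) (Pi\<^sub>M UNIV (\<lambda>_. X)) (\<lambda>\<sigma> i. \<sigma> (\<pi> i))
        = distr (Pi\<^sub>M UNIV (\<lambda>_. \<Gamma>)) (Pi\<^sub>M UNIV (\<lambda>_. \<Gamma>)) (\<lambda>\<sigma>. \<lambda>i\<in>UNIV. \<sigma> (\<pi> i))"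
      using \<Gamma> by (intro distr_cong sets_PiM_cong) auto
    also have "\<dots> = Pi\<^sub>M UNIV (\<lambda>_. \<Gamma>)"
      using distr_PiM_reindex[of UNIV "\<lambda>_. \<Gamma>" \<pi> UNIV] \<Gamma> \<pi> by simp
    finally show "distr (Pi\<^sub>M UNIV (\<lambda>_. \<Gamma>)) (Pi\<^sub>M UNIV (\<lambda>_. X)) (\<lambda>\<sigma> i. \<sigma> (\<pi> i)) = Pi\<^sub>M UNIV (\<lambda>_. \<Gamma>)" .
  qed
  finally show ?thesis .
qed

subsection \<open>Cylinder functions of the overlaps\<close>

lemma cylinder_fun_continuous:
  assumes "cylinder_fun s F"
  shows "continuous_on UNIV (\<lambda>q. F (upper s q))"
proof -
  have "continuous_map euclidean (product_topology (\<lambda>_. euclideanreal) {(i, j). i < j \<and> j < s}) (upper s)"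
    unfolding continuous_map_componentwise upper_def
    by (auto simp: continuous_on_entry)
  then have "continuous_map euclidean euclideanreal (F \<circ> upper s)"
    using assms unfolding cylinder_fun_def by (rule continuous_map_compose)
  then show ?thesis by (simp add: o_def)
qed

lemma matrix_measurable:
  fixes R :: "'a \<Rightarrow> 'a \<Rightarrow> real"
  assumes R: "(\<lambda>(a, b). R a b) \<in> borel_measurable (X \<Otimes>\<^sub>M X)"
  shows "(\<lambda>\<sigma> i j. if i \<in> I \<and> j \<in> I then R (\<sigma> i) (\<sigma> j) else 0) \<in> Pi\<^sub>M I (\<lambda>_. X) \<rightarrow>\<^sub>M (borel :: (nat \<Rightarrow> nat \<Rightarrow> real) measure)"
proof (intro measurable_coordinatewise_then_product)
  fix i j :: nat
  show "(\<lambda>\<sigma>. if i \<in> I \<and> j \<in> I then R (\<sigma> i) (\<sigma> j) else 0) \<in> borel_measurable (Pi\<^sub>M I (\<lambda>_. X))"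
  proof (cases "i \<in> I \<and> j \<in> I")
    case True
    then have "(\<lambda>\<sigma>. (\<sigma> i, \<sigma> j)) \<in> Pi\<^sub>M I (\<lambda>_. X) \<rightarrow>\<^sub>M X \<Otimes>\<^sub>M X" by auto
    from measurable_compose[OF this R] True show ?thesis by simp
  qed auto
qed

lemma matrix_measurable_UNIV:
  fixes R :: "'a \<Rightarrow> 'a \<Rightarrow> real"
  assumes R: "(\<lambda>(a, b). R a b) \<in> borel_measurable (X \<Otimes>\<^sub>M X)"
  shows "(\<lambda>\<sigma> i j. R (\<sigma> i) (\<sigma> j)) \<in> Pi\<^sub>M UNIV (\<lambda>_. X) \<rightarrow>\<^sub>M (borel :: (nat \<Rightarrow> nat \<Rightarrow> real) measure)"
  using matrix_measurable[OF R, of UNIV] by simp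

lemma cylinder_overlap_measurable:
  fixes R :: "'a \<Rightarrow> 'a \<Rightarrow> real"
  assumes R: "(\<lambda>(a, b). R a b) \<in> borel_measurable (X \<Otimes>\<^sub>M X)" and F: "cylinder_fun s F" and I: "{..<s} \<subseteq> I"
  shows "(\<lambda>\<sigma>. F (upper s (\<lambda>i j. R (\<sigma> i) (\<sigma> j)))) \<in> borel_measurable (Pi\<^sub>M I (\<lambda>_. X))"
proof -
  have "i \<in> I" if "i < s" for i using I that by auto
  then have "upper s (\<lambda>i j. if i \<in> I \<and> j \<in> I then R (\<sigma> i) (\<sigma> j) else 0) = upper s (\<lambda>i j. R (\<sigma> i) (\<sigma> j))" for \<sigma>
    by (auto simp: upper_def fun_eq_iff restrict_def)
  with measurable_compose[OF matrix_measurable[OF R, of I]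
      borel_measurable_continuous_onI[OF cylinder_fun_continuous[OF F]]]
  show ?thesis by simp
qed

lemma cylinder_fun_bounded:
  assumes F: "cylinder_fun s F"
  obtains C where "\<And>q. (\<And>i j. i < s \<Longrightarrow> j < s \<Longrightarrow> \<bar>q i j\<bar> \<le> B) \<Longrightarrow> \<bar>F (upper s q)\<bar> \<le> C"
proof -
  have "compact ((\<lambda>q. F (upper s q)) ` {q. \<forall>i j. \<bar>q i j\<bar> \<le> max B 0})"
    by (intro compact_continuous_image continuous_on_subset[OF cylinder_fun_continuous[OF F]] compact_box) simp
  then obtain C where C: "\<forall>q. (\<forall>i j. \<bar>q i j\<bar> \<le> max B 0) \<longrightarrow> \<bar>F (upper s q)\<bar> \<le> C"
    unfolding bounded_iff by (auto dest!: compact_imp_bounded simp: bounded_iff)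
  show ?thesis
  proof
    fix q :: "nat \<Rightarrow> nat \<Rightarrow> real" assume q: "\<And>i j. i < s \<Longrightarrow> j < s \<Longrightarrow> \<bar>q i j\<bar> \<le> B"
    have "upper s q = upper s (\<lambda>i j. if i < s \<and> j < s then q i j else 0)"
      by (auto simp: upper_def fun_eq_iff restrict_def)
    then show "\<bar>F (upper s q)\<bar> \<le> C"
      using C[rule_format, of "\<lambda>i j. if i < s \<and> j < s then q i j else 0"] q by (auto simp: le_max_iff_disj)
  qed
qed

lemma integral_cylinder_replicas:
  fixes R :: "'a \<Rightarrow> 'a \<Rightarrow> real"
  assumes \<mu>: "\<mu> \<in> space (prob_algebra (prob_algebra X))"
    and R: "(\<lambda>(a, b). R a b) \<in> borel_measurable (X \<Otimes>\<^sub>M X)"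
    and bound: "\<And>a b. a \<in> space X \<Longrightarrow> b \<in> space X \<Longrightarrow> \<bar>R a b\<bar> \<le> B"
    and F: "cylinder_fun s F"
  shows "(\<integral>\<Gamma>. (\<integral>\<sigma>. F (upper s (\<lambda>i j. R (\<sigma> i) (\<sigma> j))) \<partial>Pi\<^sub>M {..<s} (\<lambda>_. \<Gamma>)) \<partial>\<mu>) =
    (\<integral>\<sigma>. F (upper s (\<lambda>i j. R (\<sigma> i) (\<sigma> j))) \<partial>replicas \<mu>)"
proof -
  have up_restrict: "upper s (\<lambda>i j. R (restrict \<sigma> {..<s} i) (restrict \<sigma> {..<s} j)) = upper s (\<lambda>i j. R (\<sigma> i) (\<sigma> j))" for \<sigma>
    by (auto simp: upper_def fun_eq_iff restrict_def)
  obtain C where C: "\<And>q. (\<And>i j. i < s \<Longrightarrow> j < s \<Longrightarrow> \<bar>q i j\<bar> \<le> B) \<Longrightarrow> \<bar>F (upper s q)\<bar> \<le> C"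
    by (rule cylinder_fun_bounded[OF F, where B = B]) blast
  have "(\<integral>\<sigma>. F (upper s (\<lambda>i j. R (\<sigma> i) (\<sigma> j))) \<partial>replicas \<mu>)
      = (\<integral>\<Gamma>. (\<integral>\<sigma>. F (upper s (\<lambda>i j. R (\<sigma> i) (\<sigma> j))) \<partial>Pi\<^sub>M UNIV (\<lambda>_. \<Gamma>)) \<partial>\<mu>)"
  proof (rule integral_replicas[OF \<mu> cylinder_overlap_measurable[OF R F subset_UNIV]])
    fix \<sigma> :: "nat \<Rightarrow> 'a" assume "\<sigma> \<in> UNIV \<rightarrow>\<^sub>E space X"
    then show "\<bar>F (upper s (\<lambda>i j. R (\<sigma> i) (\<sigma> j)))\<bar> \<le> C"
      by (intro C bound) (auto simp: PiE_iff)
  qed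
  also have "\<dots> = (\<integral>\<Gamma>. (\<integral>\<sigma>. F (upper s (\<lambda>i j. R (\<sigma> i) (\<sigma> j))) \<partial>Pi\<^sub>M {..<s} (\<lambda>_. \<Gamma>)) \<partial>\<mu>)"
  proof (rule Bochner_Integration.integral_cong[OF refl])
    fix \<Gamma> assume "\<Gamma> \<in> space \<mu>"
    then have "\<Gamma> \<in> space (prob_algebra X)"
      using \<mu> by (auto simp: space_prob_algebra[of "prob_algebra X"] dest!: sets_eq_imp_space_eq)
    from integral_power_restrict[OF this cylinder_overlap_measurable[OF R F order.refl]]
    show "(\<integral>\<sigma>. F (upper s (\<lambda>i j. R (\<sigma> i) (\<sigma> j))) \<partial>Pi\<^sub>M UNIV (\<lambda>_. \<Gamma>))
        = (\<integral>\<sigma>. F (upper s (\<lambda>i j. R (\<sigma> i) (\<sigma> j))) \<partial>Pi\<^sub>M {..<s} (\<lambda>_. \<Gamma>))"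
      unfolding up_restrict by simp
  qed
  finally show ?thesis by simp
qed

text \<open>The law of the matrix of overlaps of the replicas. Where this matrix is not a covariance
  matrix, which is a null event in all uses, it is replaced by the identity matrix.\<close>

definition overlap_matrix :: "('a \<Rightarrow> 'a \<Rightarrow> real) \<Rightarrow> (nat \<Rightarrow> 'a) \<Rightarrow> nat \<Rightarrow> nat \<Rightarrow> real" where
  "overlap_matrix R \<sigma> =
    (if (\<lambda>i j. R (\<sigma> i) (\<sigma> j)) \<in> cov_matrices then (\<lambda>i j. R (\<sigma> i) (\<sigma> j)) else (\<lambda>i j. if i = j then 1 else 0))"

definition overlap_law :: "('a \<Rightarrow> 'a \<Rightarrow> real) \<Rightarrow> 'a measure measure \<Rightarrow> (nat \<Rightarrow> nat \<Rightarrow> real) measure" where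
  "overlap_law R \<mu> = distr (replicas \<mu>) (restrict_space borel cov_matrices) (overlap_matrix R)"

lemma identity_in_cov_matrices: "(\<lambda>i j. if i = j then 1 else 0) \<in> cov_matrices"
proof -
  have "(\<Sum>i<n. \<Sum>j<n. c i * c j * (if i = j then 1 else 0)) = (\<Sum>i<n. (c i)\<^sup>2)" for n and c :: "nat \<Rightarrow> real"
    by (intro sum.cong refl) (simp add: power2_eq_square if_distrib cong: if_cong)
  then show ?thesis by (simp add: cov_matrices_def sum_nonneg)
qed

lemma overlap_matrix_measurable:
  assumes \<mu>: "\<mu> \<in> space (prob_algebra (prob_algebra X))"
    and R: "(\<lambda>(a, b). R a b) \<in> borel_measurable (X \<Otimes>\<^sub>M X)"
  shows "overlap_matrix R \<in> replicas \<mu> \<rightarrow>\<^sub>M restrict_space borel cov_matrices"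
proof (rule measurable_restrict_space2)
  note [measurable] = borel_closed[OF closed_cov_matrices]
  have [measurable]: "(\<lambda>\<sigma> i j. R (\<sigma> i) (\<sigma> j)) \<in> borel_measurable (replicas \<mu>)"
    using matrix_measurable_UNIV[OF R] by (simp add: sets_replicas[OF \<mu>] cong: measurable_cong_sets)
  show "overlap_matrix R \<in> borel_measurable (replicas \<mu>)"
    unfolding overlap_matrix_def by measurable
qed (auto simp: overlap_matrix_def identity_in_cov_matrices)

lemma ROSt_overlap_law:
  assumes \<mu>: "\<mu> \<in> space (prob_algebra (prob_algebra X))"
    and R: "(\<lambda>(a, b). R a b) \<in> borel_measurable (X \<Otimes>\<^sub>M X)"
  shows "ROSt (overlap_law R \<mu>)"
  unfolding ROSt_def
proof (intro conjI allI impI)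
  note mat = overlap_matrix_measurable[OF \<mu> R]
  show "prob_space (overlap_law R \<mu>)"
    unfolding overlap_law_def by (intro prob_space.prob_space_distr prob_space_replicas[OF \<mu>] mat)
  show s: "sets (overlap_law R \<mu>) = sets (restrict_space borel cov_matrices)"
    by (simp add: overlap_law_def)
  fix \<pi> :: "nat \<Rightarrow> nat" assume "bij \<pi> \<and> finite {i. \<pi> i \<noteq> i}"
  then have \<pi>: "bij \<pi>" by simp
  let ?C = "restrict_space borel cov_matrices :: (nat \<Rightarrow> nat \<Rightarrow> real) measure"
  let ?p = "\<lambda>q i j. q (\<pi> i) (\<pi> j) :: real"
  have p_meas: "?p \<in> ?C \<rightarrow>\<^sub>M ?C"
  proof (rule measurable_restrict_space2)
    have "?p \<in> borel_measurable borel"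
      by (intro borel_measurable_continuous_onI continuous_on_coordinatewise_then_product continuous_on_entry)
    then show "?p \<in> ?C \<rightarrow>\<^sub>M borel" by (rule measurable_restrict_space1)
  qed (auto simp: space_restrict_space intro: cov_matrices_reindex)
  have reindex_meas: "(\<lambda>\<sigma> i. \<sigma> (\<pi> i)) \<in> replicas \<mu> \<rightarrow>\<^sub>M Pi\<^sub>M UNIV (\<lambda>_. X)"
    by (subst measurable_cong_sets[OF sets_replicas[OF \<mu>] refl], rule measurable_PiM_single')
      (auto simp: space_PiM)
  have iff: "(\<lambda>i j. R (\<sigma> (\<pi> i)) (\<sigma> (\<pi> j))) \<in> cov_matrices \<longleftrightarrow> (\<lambda>i j. R (\<sigma> i) (\<sigma> j)) \<in> cov_matrices" for \<sigma>
    using cov_matrices_reindex[of "\<lambda>i j. R (\<sigma> i) (\<sigma> j)" \<pi>]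
      cov_matrices_reindex[of "\<lambda>i j. R (\<sigma> (\<pi> i)) (\<sigma> (\<pi> j))" "inv \<pi>"]
    by (auto simp: surj_f_inv_f[OF bij_is_surj[OF \<pi>]])
  \<comment> \<open>renaming the entries amounts to renaming the replicas, which are exchangeable\<close>
  have commute: "?p \<circ> overlap_matrix R = overlap_matrix R \<circ> (\<lambda>\<sigma> i. \<sigma> (\<pi> i))"
    by (rule ext) (auto simp: overlap_matrix_def iff inj_eq[OF bij_is_inj[OF \<pi>]] fun_eq_iff)
  have "distr (overlap_law R \<mu>) (overlap_law R \<mu>) ?p = distr (overlap_law R \<mu>) ?C ?p"
    by (rule distr_cong) (auto simp: s)
  also have "\<dots> = distr (replicas \<mu>) ?C (?p \<circ> overlap_matrix R)"
    unfolding overlap_law_def by (rule distr_distr[OF p_meas mat])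
  also have "\<dots> = distr (distr (replicas \<mu>) (Pi\<^sub>M UNIV (\<lambda>_. X)) (\<lambda>\<sigma> i. \<sigma> (\<pi> i))) ?C (overlap_matrix R)"
    unfolding commute
    by (rule distr_distr[symmetric, OF _ reindex_meas])
      (use mat in \<open>simp add: sets_replicas[OF \<mu>] cong: measurable_cong_sets\<close>)
  also have "\<dots> = overlap_law R \<mu>"
    unfolding replicas_reindex[OF \<mu> bij_is_inj[OF \<pi>]] overlap_law_def ..
  finally show "distr (overlap_law R \<mu>) (overlap_law R \<mu>) ?p = overlap_law R \<mu>" .
qed

lemma integral_overlap_law:
  fixes R :: "'a \<Rightarrow> 'a \<Rightarrow> real"
  assumes \<mu>: "\<mu> \<in> space (prob_algebra (prob_algebra X))"
    and R: "(\<lambda>(a, b). R a b) \<in> borel_measurable (X \<Otimes>\<^sub>M X)"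
    and cov: "AE \<sigma> in replicas \<mu>. (\<lambda>i j. R (\<sigma> i) (\<sigma> j)) \<in> cov_matrices"
    and F: "cylinder_fun s F"
  shows "(\<integral>q. F (upper s q) \<partial>overlap_law R \<mu>) = (\<integral>\<sigma>. F (upper s (\<lambda>i j. R (\<sigma> i) (\<sigma> j))) \<partial>replicas \<mu>)"
proof -
  note mat = overlap_matrix_measurable[OF \<mu> R]
  note meas = borel_measurable_continuous_onI[OF cylinder_fun_continuous[OF F]]
  have "(\<lambda>\<sigma>. F (upper s (\<lambda>i j. R (\<sigma> i) (\<sigma> j)))) \<in> borel_measurable (replicas \<mu>)"
    using measurable_compose[OF matrix_measurable_UNIV[OF R] meas]
    by (simp add: sets_replicas[OF \<mu>] cong: measurable_cong_sets)
  moreover have "(\<lambda>\<sigma>. F (upper s (overlap_matrix R \<sigma>))) \<in> borel_measurable (replicas \<mu>)"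
    by (rule measurable_compose[OF mat measurable_restrict_space1[OF meas]])
  ultimately have "(\<integral>\<sigma>. F (upper s (overlap_matrix R \<sigma>)) \<partial>replicas \<mu>)
      = (\<integral>\<sigma>. F (upper s (\<lambda>i j. R (\<sigma> i) (\<sigma> j))) \<partial>replicas \<mu>)"
    using cov by (intro integral_cong_AE) (auto simp: overlap_matrix_def)
  then show ?thesis
    unfolding overlap_law_def by (simp add: integral_distr[OF mat measurable_restrict_space1[OF meas]])
qed

section \<open>Replacing overlaps by spins at distinct sites\<close>

lemma prod_abs_le_1:
  fixes f :: "'a \<Rightarrow> real"
  assumes "\<And>x. x \<in> A \<Longrightarrow> \<bar>f x\<bar> \<le> 1"
  shows "\<bar>\<Prod>x\<in>A. f x\<bar> \<le> 1"
  unfolding abs_prod using assms by (intro prod_le_1) auto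

lemma average_abs_le_1:
  fixes f :: "nat \<Rightarrow> real"
  assumes "\<And>x. x < n \<Longrightarrow> \<bar>f x\<bar> \<le> 1"
  shows "\<bar>(\<Sum>x<n. f x) / real n\<bar> \<le> 1"
proof (cases "n = 0")
  case False
  have "\<bar>\<Sum>x<n. f x\<bar> \<le> (\<Sum>x<n. 1)"
    using assms by (intro order.trans[OF sum_abs] sum_mono) auto
  with False show ?thesis by (simp add: field_simps)
qed simp

text \<open>Suppose that in the product of \<open>m\<close> averages over \<open>n\<close> sites the factors are replaced by single
  sites one after the other, factor \<open>a\<close> by the site \<open>a\<close>. If all sites \<open>x \<ge> a\<close> are equivalent at
  step \<open>a\<close>, only the \<open>a\<close> sites already in use cause an error, so that the step costs at most
  \<open>2 a / n\<close>.\<close>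

lemma (in prob_space) prod_averages_decouple:
  fixes \<xi> :: "nat \<Rightarrow> nat \<Rightarrow> 'a \<Rightarrow> real"
  assumes meas [measurable]: "\<And>e x. \<xi> e x \<in> borel_measurable M"
    and bound: "\<And>e x \<omega>. e < m \<Longrightarrow> x < n \<Longrightarrow> \<omega> \<in> space M \<Longrightarrow> \<bar>\<xi> e x \<omega>\<bar> \<le> 1"
    and n: "0 < n" "m \<le> n"
    and swap: "\<And>a x. a < m \<Longrightarrow> a < x \<Longrightarrow> x < n \<Longrightarrow>
      expectation (\<lambda>\<omega>. (\<Prod>e<a. \<xi> e e \<omega>) * \<xi> a x \<omega> * (\<Prod>e\<in>{a<..<m}. (\<Sum>y<n. \<xi> e y \<omega>) / real n)) =
      expectation (\<lambda>\<omega>. (\<Prod>e<a. \<xi> e e \<omega>) * \<xi> a a \<omega> * (\<Prod>e\<in>{a<..<m}. (\<Sum>y<n. \<xi> e y \<omega>) / real n))"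
  shows "\<bar>expectation (\<lambda>\<omega>. \<Prod>e<m. (\<Sum>x<n. \<xi> e x \<omega>) / real n) - expectation (\<lambda>\<omega>. \<Prod>e<m. \<xi> e e \<omega>)\<bar>
    \<le> 2 * (real m)\<^sup>2 / real n"
proof -
  define r where "r e \<omega> = (\<Sum>x<n. \<xi> e x \<omega>) / real n" for e \<omega>
  define V where "V a x = expectation (\<lambda>\<omega>. (\<Prod>e<a. \<xi> e e \<omega>) * \<xi> a x \<omega> * (\<Prod>e\<in>{a<..<m}. r e \<omega>))" for a x
  define H where "H a = expectation (\<lambda>\<omega>. (\<Prod>e<a. \<xi> e e \<omega>) * (\<Prod>e\<in>{a..<m}. r e \<omega>))" for a
  have [measurable]: "r e \<in> borel_measurable M" for e
    unfolding r_def by measurable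
  have r_bound: "\<bar>r e \<omega>\<bar> \<le> 1" if "e < m" "\<omega> \<in> space M" for e \<omega>
    unfolding r_def using bound that by (intro average_abs_le_1) auto
  have term_bound: "\<bar>(\<Prod>e<a. \<xi> e e \<omega>) * \<xi> a x \<omega> * (\<Prod>e\<in>{a<..<m}. r e \<omega>)\<bar> \<le> 1"
    if "a < m" "x < n" "\<omega> \<in> space M" for a x \<omega>
    unfolding abs_mult using that n
    by (intro mult_le_one mult_nonneg_nonneg prod_abs_le_1 bound r_bound) auto
  have integrable: "integrable M (\<lambda>\<omega>. (\<Prod>e<a. \<xi> e e \<omega>) * \<xi> a x \<omega> * (\<Prod>e\<in>{a<..<m}. r e \<omega>))"
    if "a < m" "x < n" for a x
    by (rule integrable_const_bound[of _ 1]) (use term_bound that in auto)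
  have V_bound: "\<bar>V a x\<bar> \<le> 1" if "a < m" "x < n" for a x
  proof -
    have "\<bar>V a x\<bar> \<le> expectation (\<lambda>\<omega>. \<bar>(\<Prod>e<a. \<xi> e e \<omega>) * \<xi> a x \<omega> * (\<Prod>e\<in>{a<..<m}. r e \<omega>)\<bar>)"
      unfolding V_def by (rule integral_abs_bound)
    also have "\<dots> \<le> expectation (\<lambda>\<omega>. 1)"
      using integrable that term_bound by (intro integral_mono) auto
    also have "\<dots> = 1" by (simp add: prob_space)
    finally show ?thesis .
  qed
  have step: "\<bar>H a - H (Suc a)\<bar> \<le> 2 * real m / real n" if a: "a < m" for a
  proof -
    have "{a..<m} = insert a {a<..<m}" using a by auto
    then have "(\<lambda>\<omega>. (\<Prod>e<a. \<xi> e e \<omega>) * (\<Prod>e\<in>{a..<m}. r e \<omega>)) =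
        (\<lambda>\<omega>. (\<Sum>x<n. (\<Prod>e<a. \<xi> e e \<omega>) * \<xi> a x \<omega> * (\<Prod>e\<in>{a<..<m}. r e \<omega>)) / real n)"
      by (simp add: r_def[of a] sum_distrib_left sum_distrib_right mult.assoc fun_eq_iff)
    then have H1: "H a = (\<Sum>x<n. V a x) / real n"
      unfolding H_def V_def using integrable[OF a] by (simp add: Bochner_Integration.integral_sum)
    have "{Suc a..<m} = {a<..<m}" by auto
    then have H2: "H (Suc a) = V a a"
      unfolding H_def V_def by (simp add: ac_simps)
    have V_eq: "V a x = V a a" if "\<not> x < a" "x < n" for x
      using swap[OF a, of x] that unfolding V_def r_def by (cases "x = a") auto
    have "\<bar>H a - H (Suc a)\<bar> = \<bar>\<Sum>x<n. V a x - V a a\<bar> / real n"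
      unfolding H1 H2 using n by (simp add: sum_subtractf field_simps)
    also have "\<dots> \<le> (\<Sum>x<n. if x < a then 2 else 0) / real n"
    proof (intro divide_right_mono order.trans[OF sum_abs] sum_mono)
      fix x assume "x \<in> {..<n}"
      then show "\<bar>V a x - V a a\<bar> \<le> (if x < a then 2 else 0)"
        using V_eq[of x] V_bound[OF a, of x] V_bound[OF a, of a] a n by (auto simp: abs_le_iff)
    qed simp
    also have "(\<Sum>x<n. if x < a then 2 else 0) = (\<Sum>x<a. 2 :: real)"
      using a n by (intro sum.mono_neutral_cong_right) auto
    also have "(\<Sum>x<a. 2 :: real) / real n \<le> 2 * real m / real n"
      using a by (intro divide_right_mono) auto
    finally show ?thesis .
  qed
  have "\<bar>H 0 - H m\<bar> = \<bar>\<Sum>a<m. H a - H (Suc a)\<bar>"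
    by (simp add: sum_lessThan_telescope')
  also have "\<dots> \<le> (\<Sum>a<m. 2 * real m / real n)"
    by (intro order.trans[OF sum_abs] sum_mono step) auto
  also have "\<dots> = 2 * (real m)\<^sup>2 / real n"
    by (simp add: power2_eq_square)
  finally show ?thesis
    by (simp add: H_def r_def atLeast0LessThan)
qed

section \<open>The Gibbs measures and their invariance under permutations of sites\<close>

lemma finite_configs: "finite (configs N)"
  unfolding configs_def by (intro finite_PiE) auto

lemma configs_not_empty: "configs N \<noteq> {}"
  by (simp add: configs_def PiE_eq_empty_iff)

lemma partition_function_pos: "partition_function \<beta> N J > 0"
  unfolding partition_function_def
  by (intro sum_pos finite_configs configs_not_empty) auto

lemma sets_gibbs: "sets (gibbs \<beta> N J) = sets (count_space (configs N))"
  by (simp add: gibbs_def sets_point_measure)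

lemma space_gibbs: "space (gibbs \<beta> N J) = configs N"
  by (simp add: gibbs_def space_point_measure)

lemma emeasure_gibbs:
  assumes "A \<subseteq> configs N"
  shows "emeasure (gibbs \<beta> N J) A =
    (\<Sum>\<sigma>\<in>A. ennreal (exp (- \<beta> * hamiltonian N J \<sigma>) / partition_function \<beta> N J))"
  unfolding gibbs_def using assms finite_configs by (rule emeasure_point_measure_finite[rotated])

lemma prob_space_gibbs: "prob_space (gibbs \<beta> N J)"
proof
  have "emeasure (gibbs \<beta> N J) (space (gibbs \<beta> N J)) =
      ennreal (\<Sum>\<sigma>\<in>configs N. exp (- \<beta> * hamiltonian N J \<sigma>) / partition_function \<beta> N J)"
    unfolding space_gibbs emeasure_gibbs[OF order.refl]
    using partition_function_pos[of \<beta> N J] by (intro sum_ennreal) auto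
  also have "\<dots> = 1"
    using partition_function_pos[of \<beta> N J]
    by (simp add: sum_divide_distrib[symmetric]) (simp add: partition_function_def)
  finally show "emeasure (gibbs \<beta> N J) (space (gibbs \<beta> N J)) = 1" .
qed

lemma hamiltonian_measurable [measurable]:
  "(\<lambda>J. hamiltonian N J \<sigma>) \<in> borel_measurable (coupling_law sd)"
proof -
  have [measurable]: "(\<lambda>J. J {x, y}) \<in> borel_measurable (coupling_law sd)" if "x < y" for x y
    unfolding coupling_law_def
    by (rule measurable_compose[OF measurable_component_singleton]) (use that in \<open>auto simp: edges_def\<close>)
  show ?thesis
    unfolding hamiltonian_def
    by (intro borel_measurable_times borel_measurable_const borel_measurable_sum) auto
qed

lemma gibbs_kernel: "gibbs \<beta> N \<in> coupling_law sd \<rightarrow>\<^sub>M prob_algebra (count_space (configs N))"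
proof (intro measurable_prob_algebraI measurable_subprob_algebra prob_space_gibbs
    prob_space_imp_subprob_space sets_gibbs)
  fix A assume "A \<in> sets (count_space (configs N))"
  then have "A \<subseteq> configs N" by simp
  then show "(\<lambda>J. emeasure (gibbs \<beta> N J) A) \<in> borel_measurable (coupling_law sd)"
    by (simp add: emeasure_gibbs partition_function_def)
qed

lemma prob_space_coupling_law:
  assumes "sd > 0"
  shows "prob_space (coupling_law sd)"
  unfolding coupling_law_def using assms by (intro prob_space_PiM prob_space_normal_density)

text \<open>The law of the random Gibbs measure.\<close>

definition gibbs_mixture :: "real \<Rightarrow> real \<Rightarrow> nat \<Rightarrow> (nat \<Rightarrow> real) measure measure" where
  "gibbs_mixture sd \<beta> N = distr (coupling_law sd) (prob_algebra (count_space (configs N))) (gibbs \<beta> N)"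

lemma gibbs_mixture_space:
  assumes "sd > 0"
  shows "gibbs_mixture sd \<beta> N \<in> space (prob_algebra (prob_algebra (count_space (configs N))))"
  unfolding gibbs_mixture_def space_prob_algebra[of "prob_algebra (count_space (configs N))"]
  using prob_space.prob_space_distr[OF prob_space_coupling_law[OF assms] gibbs_kernel] by simp

lemma power_integral_measurable:
  fixes f :: "(nat \<Rightarrow> 'a) \<Rightarrow> real"
  assumes f: "f \<in> borel_measurable (Pi\<^sub>M I (\<lambda>_. X))"
  shows "(\<lambda>\<Gamma>. \<integral>\<sigma>. f \<sigma> \<partial>Pi\<^sub>M I (\<lambda>_. \<Gamma>)) \<in> borel_measurable (prob_algebra X)"
  by (rule measurable_compose[OF measurable_prob_algebraD[OF power_kernel_measurable]
        integral_measurable_subprob_algebra[OF f]])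

lemma gibbs_mean_eq_mixture:
  assumes f: "f \<in> borel_measurable (Pi\<^sub>M I (\<lambda>_. count_space (configs N)))"
  shows "gibbs_mean sd \<beta> N I (\<lambda>_. f) = (\<integral>\<Gamma>. (\<integral>\<sigma>. f \<sigma> \<partial>Pi\<^sub>M I (\<lambda>_. \<Gamma>)) \<partial>gibbs_mixture sd \<beta> N)"
  unfolding gibbs_mean_def gibbs_mixture_def
  by (rule integral_distr[symmetric, OF gibbs_kernel power_integral_measurable[OF f]])

lemma gibbs_mean_eq_replicas:
  assumes "sd > 0" and f: "f \<in> borel_measurable (Pi\<^sub>M UNIV (\<lambda>_. count_space (configs N)))"
    and bound: "\<And>\<sigma>. \<sigma> \<in> UNIV \<rightarrow>\<^sub>E configs N \<Longrightarrow> \<bar>f \<sigma>\<bar> \<le> B"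
  shows "gibbs_mean sd \<beta> N UNIV (\<lambda>_. f) = (\<integral>\<sigma>. f \<sigma> \<partial>replicas (gibbs_mixture sd \<beta> N))"
  unfolding gibbs_mean_eq_mixture[OF f]
  by (rule integral_replicas[OF gibbs_mixture_space[OF \<open>sd > 0\<close>] f, symmetric]) (rule bound, simp)

lemma spin_measurable [measurable]:
  "(\<lambda>\<sigma>. \<sigma> i x) \<in> borel_measurable (Pi\<^sub>M UNIV (\<lambda>_::nat. count_space (configs N)))"
proof -
  have "(\<lambda>\<sigma>. \<sigma> i) \<in> Pi\<^sub>M UNIV (\<lambda>_::nat. count_space (configs N)) \<rightarrow>\<^sub>M count_space (configs N)"
    by simp
  moreover have "(\<lambda>s. s x) \<in> borel_measurable (count_space (configs N))" by simp
  ultimately show ?thesis by (rule measurable_compose)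
qed

lemma config_abs: "\<sigma> \<in> configs N \<Longrightarrow> x < N \<Longrightarrow> \<bar>\<sigma> x\<bar> = 1"
proof -
  assume "\<sigma> \<in> configs N" "x < N"
  then have "\<sigma> x \<in> {-1, 1}" by (auto simp: configs_def PiE_iff)
  then show ?thesis by auto
qed

subsection \<open>Permuting the sites\<close>

lemma sum_lower_triangle:
  fixes a :: "nat \<Rightarrow> nat \<Rightarrow> real"
  assumes "\<And>x y. a x y = a y x"
  shows "2 * (\<Sum>y<N. \<Sum>x<y. a x y) = (\<Sum>y<N. \<Sum>x<N. if x = y then 0 else a x y)"
proof (induction N)
  case (Suc N)
  have "(\<Sum>y<Suc N. \<Sum>x<Suc N. if x = y then 0 else a x y) =
      (\<Sum>y<N. \<Sum>x<N. if x = y then 0 else a x y) + (\<Sum>y<N. a N y) + (\<Sum>x<N. a x N)"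
    by (simp add: sum.distrib)
  also have "(\<Sum>y<N. a N y) = (\<Sum>x<N. a x N)"
    using assms by (intro sum.cong) auto
  finally show ?case using Suc by (simp add: algebra_simps)
qed simp

text \<open>Moving the couplings and the spins along the same permutation of the sites leaves the energy
  unchanged.\<close>

lemma hamiltonian_permute:
  assumes t: "t permutes {..<N}"
  shows "hamiltonian N (\<lambda>e\<in>edges. J (t ` e)) (\<sigma> \<circ> t) = hamiltonian N J \<sigma>"
proof -
  define a where "a x y = J {x, y} * \<sigma> x * \<sigma> y" for x y
  have sym: "a x y = a y x" for x y
    by (simp add: a_def insert_commute)
  have "(\<Sum>y<N. \<Sum>x<y. (\<lambda>e\<in>edges. J (t ` e)) {x, y} * (\<sigma> \<circ> t) x * (\<sigma> \<circ> t) y) = (\<Sum>y<N. \<Sum>x<y. a (t x) (t y))"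
    by (intro sum.cong refl) (auto simp: a_def edges_def)
  moreover have "2 * (\<Sum>y<N. \<Sum>x<y. a (t x) (t y)) = 2 * (\<Sum>y<N. \<Sum>x<y. a x y)"
  proof -
    have "2 * (\<Sum>y<N. \<Sum>x<y. a (t x) (t y)) = (\<Sum>y<N. \<Sum>x<N. if x = y then 0 else a (t x) (t y))"
      by (rule sum_lower_triangle) (rule sym)
    also have "\<dots> = (\<Sum>y<N. \<Sum>x<N. if t x = t y then 0 else a (t x) (t y))"
      using permutes_inj[OF t] by (simp add: inj_eq)
    also have "\<dots> = (\<Sum>y<N. \<Sum>x<N. if x = t y then 0 else a x (t y))"
      using sum.permute[OF t, of "\<lambda>x. if x = t y then 0 else a x (t y)" for y] by (simp add: o_def)
    also have "\<dots> = (\<Sum>y<N. \<Sum>x<N. if x = y then 0 else a x y)"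
      using sum.permute[OF t, of "\<lambda>y. \<Sum>x<N. if x = y then 0 else a x y"] by (simp add: o_def)
    also have "\<dots> = 2 * (\<Sum>y<N. \<Sum>x<y. a x y)"
      by (rule sum_lower_triangle[symmetric]) (rule sym)
    finally show ?thesis .
  qed
  ultimately show ?thesis
    by (simp add: hamiltonian_def a_def)
qed

lemma configs_permute:
  assumes t: "t permutes {..<N}"
  shows "bij_betw (\<lambda>\<sigma>. \<sigma> \<circ> t) (configs N) (configs N)"
proof (rule bij_betw_byWitness[where f' = "\<lambda>\<sigma>. \<sigma> \<circ> inv t"])
  have *: "\<sigma> \<circ> p \<in> configs N" if "p permutes {..<N}" "\<sigma> \<in> configs N" for \<sigma> p
    using that permutes_in_image[OF that(1)] permutes_not_in[OF that(1)]
    by (auto simp: configs_def PiE_iff extensional_def)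
  show "(\<lambda>\<sigma>. \<sigma> \<circ> t) ` configs N \<subseteq> configs N" using *[OF t] by blast
  show "(\<lambda>\<sigma>. \<sigma> \<circ> inv t) ` configs N \<subseteq> configs N" using *[OF permutes_inv[OF t]] by blast
qed (auto simp: o_assoc[symmetric] permutes_inv_o[OF t])

lemma gibbs_permute_measurable:
  assumes "t permutes {..<N}"
  shows "(\<lambda>\<sigma>. \<sigma> \<circ> t) \<in> gibbs \<beta> N J \<rightarrow>\<^sub>M count_space (configs N)"
  unfolding measurable_cong_sets[OF sets_gibbs refl] measurable_count_space_eq1
  using bij_betwE[OF configs_permute[OF assms]] by auto

lemma gibbs_permute:
  assumes t: "t permutes {..<N}"
  shows "distr (gibbs \<beta> N J) (count_space (configs N)) (\<lambda>\<sigma>. \<sigma> \<circ> t) = gibbs \<beta> N (\<lambda>e\<in>edges. J (t ` e))"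
    (is "_ = gibbs \<beta> N ?J")
proof (rule measure_eqI_finite[OF _ _ finite_configs])
  note bij = configs_permute[OF t]
  have meas: "(\<lambda>\<sigma>. \<sigma> \<circ> t) \<in> gibbs \<beta> N J \<rightarrow>\<^sub>M count_space (configs N)"
    by (rule gibbs_permute_measurable[OF t])
  have Z: "partition_function \<beta> N ?J = partition_function \<beta> N J"
    unfolding partition_function_def
    using sum.reindex_bij_betw[OF bij, of "\<lambda>\<sigma>. exp (- \<beta> * hamiltonian N ?J \<sigma>)"]
    by (simp add: hamiltonian_permute[OF t])
  fix \<sigma>' assume "\<sigma>' \<in> configs N"
  then obtain \<sigma> where \<sigma>: "\<sigma> \<in> configs N" "\<sigma>' = \<sigma> \<circ> t"
    using bij by (auto simp: bij_betw_def)
  have "(\<lambda>\<sigma>. \<sigma> \<circ> t) -` {\<sigma>'} \<inter> configs N = {\<sigma>}"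
    using bij \<sigma> by (auto simp: bij_betw_def inj_on_def)
  then have "emeasure (distr (gibbs \<beta> N J) (count_space (configs N)) (\<lambda>\<sigma>. \<sigma> \<circ> t)) {\<sigma>'} = emeasure (gibbs \<beta> N J) {\<sigma>}"
    using \<open>\<sigma>' \<in> configs N\<close> by (simp add: emeasure_distr[OF meas] space_gibbs)
  also have "\<dots> = emeasure (gibbs \<beta> N ?J) {\<sigma>'}"
    using \<sigma> \<open>\<sigma>' \<in> configs N\<close> by (simp add: emeasure_gibbs Z hamiltonian_permute[OF t])
  finally show "emeasure (distr (gibbs \<beta> N J) (count_space (configs N)) (\<lambda>\<sigma>. \<sigma> \<circ> t)) {\<sigma>'}
      = emeasure (gibbs \<beta> N ?J) {\<sigma>'}" .
qed (simp_all add: sets_gibbs)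

lemma
  assumes "sd > 0" "bij t"
  shows coupling_law_permute:
      "distr (coupling_law sd) (coupling_law sd) (\<lambda>J. \<lambda>e\<in>edges. J (t ` e)) = coupling_law sd"
    and coupling_permute_measurable:
      "(\<lambda>J. \<lambda>e\<in>edges. J (t ` e)) \<in> coupling_law sd \<rightarrow>\<^sub>M coupling_law sd"
proof -
  have edges: "t ` e \<in> edges" if "e \<in> edges" for e
  proof -
    from that obtain x y where "e = {x, y}" "x \<noteq> y" by (auto simp: edges_def)
    then have "t ` e = {t x, t y}" "t x \<noteq> t y"
      using bij_is_inj[OF \<open>bij t\<close>] by (auto simp: inj_eq)
    then show ?thesis by (auto simp: edges_def)
  qed
  have "inj_on ((`) t) edges"
    using bij_is_inj[OF \<open>bij t\<close>] by (auto simp: inj_on_def inj_image_eq_iff)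
  then show "distr (coupling_law sd) (coupling_law sd) (\<lambda>J. \<lambda>e\<in>edges. J (t ` e)) = coupling_law sd"
    using distr_PiM_reindex[of edges "\<lambda>_. density lborel (normal_density 0 sd)" "(`) t" edges]
      edges prob_space_normal_density[OF \<open>sd > 0\<close>]
    by (auto simp: coupling_law_def)
  show "(\<lambda>J. \<lambda>e\<in>edges. J (t ` e)) \<in> coupling_law sd \<rightarrow>\<^sub>M coupling_law sd"
    unfolding coupling_law_def using edges by (intro measurable_restrict measurable_component_singleton)
qed

lemma distr_power:
  assumes \<Gamma>: "prob_space \<Gamma>" and \<phi>: "\<phi> \<in> \<Gamma> \<rightarrow>\<^sub>M X"
  shows "distr (Pi\<^sub>M UNIV (\<lambda>_. \<Gamma>)) (Pi\<^sub>M UNIV (\<lambda>_. X)) (\<lambda>\<sigma> i. \<phi> (\<sigma> i)) = Pi\<^sub>M UNIV (\<lambda>_. distr \<Gamma> X \<phi>)"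
proof (rule measure_eqI_PiM_infinite)
  have meas: "(\<lambda>\<sigma> i. \<phi> (\<sigma> i)) \<in> Pi\<^sub>M UNIV (\<lambda>_. \<Gamma>) \<rightarrow>\<^sub>M Pi\<^sub>M UNIV (\<lambda>_. X)"
    using measurable_space[OF \<phi>] \<phi>
    by (intro measurable_PiM_single') (auto simp: space_PiM PiE_iff intro: measurable_compose[OF measurable_component_singleton])
  show "sets (distr (Pi\<^sub>M UNIV (\<lambda>_. \<Gamma>)) (Pi\<^sub>M UNIV (\<lambda>_. X)) (\<lambda>\<sigma> i. \<phi> (\<sigma> i))) = sets (Pi\<^sub>M UNIV (\<lambda>_. X))"
    by simp
  show "sets (Pi\<^sub>M UNIV (\<lambda>_. distr \<Gamma> X \<phi>)) = sets (Pi\<^sub>M UNIV (\<lambda>_. X))"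
    by (intro sets_PiM_cong) auto
  show "finite_measure (distr (Pi\<^sub>M UNIV (\<lambda>_. \<Gamma>)) (Pi\<^sub>M UNIV (\<lambda>_. X)) (\<lambda>\<sigma> i. \<phi> (\<sigma> i)))"
    using \<Gamma> meas by (intro prob_space.finite_measure prob_space.prob_space_distr prob_space_PiM)
  fix A and J :: "'c set" assume J: "finite J" "J \<subseteq> UNIV" and A: "\<And>i. i \<in> J \<Longrightarrow> A i \<in> sets X"
  let ?A = "prod_emb UNIV (\<lambda>_. X) J (Pi\<^sub>E J A)"
  have "(\<lambda>\<sigma> i. \<phi> (\<sigma> i)) -` ?A \<inter> space (Pi\<^sub>M UNIV (\<lambda>_. \<Gamma>))
      = prod_emb UNIV (\<lambda>_. \<Gamma>) J (\<Pi>\<^sub>E i\<in>J. \<phi> -` A i \<inter> space \<Gamma>)"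
    using measurable_space[OF \<phi>] by (auto simp: prod_emb_def space_PiM PiE_iff)
  then have "emeasure (distr (Pi\<^sub>M UNIV (\<lambda>_. \<Gamma>)) (Pi\<^sub>M UNIV (\<lambda>_. X)) (\<lambda>\<sigma> i. \<phi> (\<sigma> i))) ?A
      = emeasure (Pi\<^sub>M UNIV (\<lambda>_. \<Gamma>)) (prod_emb UNIV (\<lambda>_. \<Gamma>) J (\<Pi>\<^sub>E i\<in>J. \<phi> -` A i \<inter> space \<Gamma>))"
    using J A by (subst emeasure_distr[OF meas]) (auto intro!: sets_PiM_I)
  also have "\<dots> = (\<Prod>i\<in>J. emeasure \<Gamma> (\<phi> -` A i \<inter> space \<Gamma>))"
    using \<Gamma> J A \<phi> by (intro emeasure_PiM_emb) (auto intro: measurable_sets)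
  also have "\<dots> = (\<Prod>i\<in>J. emeasure (distr \<Gamma> X \<phi>) (A i))"
    using A \<phi> by (intro prod.cong) (auto simp: emeasure_distr)
  also have "\<dots> = emeasure (Pi\<^sub>M UNIV (\<lambda>_. distr \<Gamma> X \<phi>)) (prod_emb UNIV (\<lambda>_. distr \<Gamma> X \<phi>) J (Pi\<^sub>E J A))"
    using \<Gamma> J A \<phi> by (intro emeasure_PiM_emb[symmetric]) (auto intro: prob_space.prob_space_distr)
  also have "prod_emb UNIV (\<lambda>_. distr \<Gamma> X \<phi>) J (Pi\<^sub>E J A) = ?A"
    by (simp add: prod_emb_def)
  finally show "emeasure (distr (Pi\<^sub>M UNIV (\<lambda>_. \<Gamma>)) (Pi\<^sub>M UNIV (\<lambda>_. X)) (\<lambda>\<sigma> i. \<phi> (\<sigma> i))) ?A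
      = emeasure (Pi\<^sub>M UNIV (\<lambda>_. distr \<Gamma> X \<phi>)) ?A" .
qed

text \<open>The couplings are exchangeable, hence so are the sites after averaging over the couplings.\<close>

lemma gibbs_mean_permute:
  assumes sd: "sd > 0" and t: "t permutes {..<N}"
    and f: "f \<in> borel_measurable (Pi\<^sub>M UNIV (\<lambda>_. count_space (configs N)))"
  shows "gibbs_mean sd \<beta> N UNIV (\<lambda>_ \<sigma>. f (\<lambda>i. \<sigma> i \<circ> t)) = gibbs_mean sd \<beta> N UNIV (\<lambda>_. f)"
proof -
  let ?X = "count_space (configs N)"
  define h where "h J = (\<integral>\<sigma>. f \<sigma> \<partial>Pi\<^sub>M UNIV (\<lambda>_::nat. gibbs \<beta> N J))" for J
  have h: "h \<in> borel_measurable (coupling_law sd)"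
    unfolding h_def by (rule measurable_compose[OF gibbs_kernel power_integral_measurable[OF f]])
  have "(\<integral>\<sigma>. f (\<lambda>i. \<sigma> i \<circ> t) \<partial>Pi\<^sub>M UNIV (\<lambda>_::nat. gibbs \<beta> N J)) = h (\<lambda>e\<in>edges. J (t ` e))" for J
  proof -
    have \<phi>: "(\<lambda>\<sigma>. \<sigma> \<circ> t) \<in> gibbs \<beta> N J \<rightarrow>\<^sub>M ?X"
      by (rule gibbs_permute_measurable[OF t])
    have meas: "(\<lambda>\<sigma> i. \<sigma> i \<circ> t) \<in> Pi\<^sub>M UNIV (\<lambda>_::nat. gibbs \<beta> N J) \<rightarrow>\<^sub>M Pi\<^sub>M UNIV (\<lambda>_. ?X)"
      using measurable_space[OF \<phi>] \<phi>
      by (intro measurable_PiM_single') (auto simp: space_PiM PiE_iff intro: measurable_compose[OF measurable_component_singleton])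
    have "h (\<lambda>e\<in>edges. J (t ` e)) = (\<integral>\<sigma>. f \<sigma> \<partial>distr (Pi\<^sub>M UNIV (\<lambda>_::nat. gibbs \<beta> N J)) (Pi\<^sub>M UNIV (\<lambda>_. ?X)) (\<lambda>\<sigma> i. \<sigma> i \<circ> t))"
      unfolding h_def distr_power[OF prob_space_gibbs \<phi>] gibbs_permute[OF t] ..
    also have "\<dots> = (\<integral>\<sigma>. f (\<lambda>i. \<sigma> i \<circ> t) \<partial>Pi\<^sub>M UNIV (\<lambda>_::nat. gibbs \<beta> N J))"
      by (rule integral_distr[OF meas f])
    finally show ?thesis ..
  qed
  then have "gibbs_mean sd \<beta> N UNIV (\<lambda>_ \<sigma>. f (\<lambda>i. \<sigma> i \<circ> t)) = (\<integral>J. h (\<lambda>e\<in>edges. J (t ` e)) \<partial>coupling_law sd)"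
    by (simp add: gibbs_mean_def)
  also have "\<dots> = (\<integral>J. h J \<partial>distr (coupling_law sd) (coupling_law sd) (\<lambda>J. \<lambda>e\<in>edges. J (t ` e)))"
    by (rule integral_distr[symmetric, OF coupling_permute_measurable[OF sd permutes_bij[OF t]] h])
  also have "\<dots> = gibbs_mean sd \<beta> N UNIV (\<lambda>_. f)"
    unfolding coupling_law_permute[OF sd permutes_bij[OF t]] by (simp add: gibbs_mean_def h_def)
  finally show ?thesis .
qed

section \<open>Overlap moments of the Gibbs measures\<close>

lemma prod_list_pairs_nth: "(\<Prod>(i, j)\<leftarrow>l. q i j) = (\<Prod>e<length l. q (fst (l ! e)) (snd (l ! e)))"
  for q :: "nat \<Rightarrow> nat \<Rightarrow> real"
  by (simp add: prod.list_conv_set_nth atLeast0LessThan case_prod_beta)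

lemma fin_overlap_abs_le_1:
  assumes "\<And>x. x < n \<Longrightarrow> \<bar>s x\<bar> \<le> 1" "\<And>x. x < n \<Longrightarrow> \<bar>s' x\<bar> \<le> 1"
  shows "\<bar>fin_overlap n s s'\<bar> \<le> 1"
  unfolding fin_overlap_def using assms by (intro average_abs_le_1) (auto simp: abs_mult intro: mult_le_one)

text \<open>On the left, the overlaps of the pairs in \<open>l\<close> are averages over the first \<open>n\<close> sites; on the
  right, the \<open>e\<close>-th pair only uses the site \<open>e\<close>. The error bound does not depend on the size \<open>N\<close> of the
  system.\<close>

lemma gibbs_moment_decouple:
  assumes sd: "sd > 0" and n: "0 < n" "length l \<le> n" "n \<le> N"
  shows "\<bar>gibbs_mean sd \<beta> N UNIV (\<lambda>_ \<sigma>. \<Prod>(i, j)\<leftarrow>l. fin_overlap n (\<sigma> i) (\<sigma> j)) -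
      gibbs_mean sd \<beta> N UNIV (\<lambda>_ \<sigma>. \<Prod>e<length l. \<sigma> (fst (l ! e)) e * \<sigma> (snd (l ! e)) e)\<bar>
    \<le> 2 * (real (length l))\<^sup>2 / real n"
proof -
  let ?M = "replicas (gibbs_mixture sd \<beta> N)"
  let ?P = "Pi\<^sub>M UNIV (\<lambda>_::nat. count_space (configs N))"
  define \<xi> where "\<xi> e x \<sigma> = \<sigma> (fst (l ! e)) x * \<sigma> (snd (l ! e)) x" for e x and \<sigma> :: "nat \<Rightarrow> nat \<Rightarrow> real"
  note mix = gibbs_mixture_space[OF sd, of \<beta> N]
  interpret prob_space ?M by (rule prob_space_replicas[OF mix])
  have meas [measurable]: "\<xi> e x \<in> borel_measurable ?P" for e x
    unfolding \<xi>_def by measurable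
  have bound: "\<bar>\<xi> e x \<sigma>\<bar> \<le> 1" if "x < n" "\<sigma> \<in> UNIV \<rightarrow>\<^sub>E configs N" for e x \<sigma>
    using that n config_abs[of _ N x] by (auto simp: \<xi>_def abs_mult PiE_iff)
  have avg_bound: "\<bar>(\<Sum>x<n. \<xi> e x \<sigma>) / real n\<bar> \<le> 1" if "\<sigma> \<in> UNIV \<rightarrow>\<^sub>E configs N" for e \<sigma>
    using bound that by (intro average_abs_le_1)
  have E: "gibbs_mean sd \<beta> N UNIV (\<lambda>_. f) = expectation f"
    if "f \<in> borel_measurable ?P" "\<And>\<sigma>. \<sigma> \<in> UNIV \<rightarrow>\<^sub>E configs N \<Longrightarrow> \<bar>f \<sigma>\<bar> \<le> 1" for f
    by (rule gibbs_mean_eq_replicas[OF sd that])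
  have "\<bar>expectation (\<lambda>\<sigma>. \<Prod>e<length l. (\<Sum>x<n. \<xi> e x \<sigma>) / real n) - expectation (\<lambda>\<sigma>. \<Prod>e<length l. \<xi> e e \<sigma>)\<bar>
      \<le> 2 * (real (length l))\<^sup>2 / real n"
  proof (rule prod_averages_decouple)
    show "\<xi> e x \<in> borel_measurable ?M" for e x
      using meas by (simp add: sets_replicas[OF mix] cong: measurable_cong_sets)
    show "\<bar>\<xi> e x \<sigma>\<bar> \<le> 1" if "e < length l" "x < n" "\<sigma> \<in> space ?M" for e x \<sigma>
      using bound that by (simp add: space_replicas[OF mix])
    fix a x assume a: "a < length l" "a < x" "x < n"
    define f where "f y \<sigma> = (\<Prod>e<a. \<xi> e e \<sigma>) * \<xi> a y \<sigma> * (\<Prod>e\<in>{a<..<length l}. (\<Sum>y<n. \<xi> e y \<sigma>) / real n)" for y \<sigma>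
    have f_meas: "f y \<in> borel_measurable ?P" for y
      unfolding f_def by measurable
    have f_bound: "\<bar>f y \<sigma>\<bar> \<le> 1" if "\<sigma> \<in> UNIV \<rightarrow>\<^sub>E configs N" "y < n" for y \<sigma>
      unfolding f_def abs_mult using that a n
      by (intro mult_le_one mult_nonneg_nonneg prod_abs_le_1 bound avg_bound) auto
    \<comment> \<open>this transposition fixes the sites below \<open>a\<close> and permutes the sites of the averages\<close>
    define t where "t = Transposition.transpose a x"
    have t: "t permutes {..<n}" "t permutes {..<N}"
      unfolding t_def using a n by (auto intro!: permutes_swap_id)
    have "f a (\<lambda>i. \<sigma> i \<circ> t) = f x \<sigma>" for \<sigma>
    proof -
      have perm: "\<xi> e y (\<lambda>i. \<sigma> i \<circ> t) = \<xi> e (t y) \<sigma>" for e y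
        by (simp add: \<xi>_def)
      have "(\<Prod>e<a. \<xi> e (t e) \<sigma>) = (\<Prod>e<a. \<xi> e e \<sigma>)"
        using a by (intro prod.cong) (auto simp: t_def Transposition.transpose_def)
      moreover have "(\<Sum>y<n. \<xi> e (t y) \<sigma>) = (\<Sum>y<n. \<xi> e y \<sigma>)" for e
        using sum.permute[OF t(1), of "\<lambda>y. \<xi> e y \<sigma>"] by (simp add: o_def)
      ultimately show ?thesis
        by (simp add: f_def perm) (simp add: t_def)
    qed
    then have "gibbs_mean sd \<beta> N UNIV (\<lambda>_. f x) = gibbs_mean sd \<beta> N UNIV (\<lambda>_. f a)"
      using gibbs_mean_permute[OF sd t(2) f_meas[of a]] by (simp add: fun_eq_iff)
    then have "expectation (f x) = expectation (f a)"
      using E[OF f_meas f_bound] a by simp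
    then show "expectation (\<lambda>\<sigma>. (\<Prod>e<a. \<xi> e e \<sigma>) * \<xi> a x \<sigma> * (\<Prod>e\<in>{a<..<length l}. (\<Sum>y<n. \<xi> e y \<sigma>) / real n)) =
      expectation (\<lambda>\<sigma>. (\<Prod>e<a. \<xi> e e \<sigma>) * \<xi> a a \<sigma> * (\<Prod>e\<in>{a<..<length l}. (\<Sum>y<n. \<xi> e y \<sigma>) / real n))"
      by (simp add: f_def[abs_def])
  qed (use n in auto)
  moreover have "gibbs_mean sd \<beta> N UNIV (\<lambda>_ \<sigma>. \<Prod>e<length l. (\<Sum>x<n. \<xi> e x \<sigma>) / real n)
      = expectation (\<lambda>\<sigma>. \<Prod>e<length l. (\<Sum>x<n. \<xi> e x \<sigma>) / real n)"
    by (intro E prod_abs_le_1 avg_bound) measurable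
  moreover have "gibbs_mean sd \<beta> N UNIV (\<lambda>_ \<sigma>. \<Prod>e<length l. \<xi> e e \<sigma>) = expectation (\<lambda>\<sigma>. \<Prod>e<length l. \<xi> e e \<sigma>)"
    using n by (intro E prod_abs_le_1 bound) auto
  ultimately show ?thesis
    by (simp add: prod_list_pairs_nth fin_overlap_def \<xi>_def)
qed

lemma gibbs_pair_moment:
  assumes sd: "sd > 0" and xy: "x < N" "y < N" "x \<noteq> y" "1 < N"
  shows "gibbs_mean sd \<beta> N UNIV (\<lambda>_ \<sigma>. (\<sigma> i x * \<sigma> j x) * (\<sigma> i y * \<sigma> j y)) =
    gibbs_mean sd \<beta> N UNIV (\<lambda>_ \<sigma>. (\<sigma> i 0 * \<sigma> j 0) * (\<sigma> i 1 * \<sigma> j 1))"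
proof -
  define E where "E x y = gibbs_mean sd \<beta> N UNIV (\<lambda>_ \<sigma>. (\<sigma> i x * \<sigma> j x) * (\<sigma> i y * \<sigma> j y))" for x y
  have sym: "E x y = E y x" for x y
    unfolding E_def by (simp add: mult.commute)
  have perm: "E (t x) (t y) = E x y" if "t permutes {..<N}" for t x y
    using gibbs_mean_permute[OF sd that, of "\<lambda>\<sigma>. (\<sigma> i x * \<sigma> j x) * (\<sigma> i y * \<sigma> j y)" \<beta>]
    unfolding E_def by simp
  have zero: "E 0 y = E 0 1" if "y < N" "y \<noteq> 0" for y
    using perm[of "Transposition.transpose 1 y" 0 1] that \<open>1 < N\<close> permutes_swap_id[of 1 "{..<N}" y]
    by (simp add: Transposition.transpose_def)
  have "E x y = E 0 1"
  proof (cases "y = 0")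
    case True
    then show ?thesis using sym[of x y] zero[of x] xy by simp
  next
    case False
    have "E x y = E 0 y"
      using perm[of "Transposition.transpose 0 x" 0 y] xy False permutes_swap_id[of 0 "{..<N}" x]
      by (simp add: Transposition.transpose_def)
    with zero[OF xy(2) False] show ?thesis by simp
  qed
  then show ?thesis by (simp add: E_def)
qed

section \<open>Almost sure convergence of averages\<close>

text \<open>Averages of bounded numbers converge as soon as they converge along fourth powers.\<close>

lemma averages_converge_from_fourth_powers:
  fixes \<xi> :: "nat \<Rightarrow> real"
  assumes bound: "\<And>x. \<bar>\<xi> x\<bar> \<le> 1"
    and lim: "(\<lambda>k. (\<Sum>x<k ^ 4. \<xi> x) / real (k ^ 4)) \<longlonglongrightarrow> L"
  shows "(\<lambda>n. (\<Sum>x<n. \<xi> x) / real n) \<longlonglongrightarrow> L"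
proof -
  define A where "A n = (\<Sum>x<n. \<xi> x) / real n" for n
  \<comment> \<open>the integer part of the fourth root of \<open>n\<close>\<close>
  define r where "r n = (LEAST k. n < Suc k ^ 4)" for n :: nat
  have r_upper: "n < Suc (r n) ^ 4" for n
  proof -
    have "n < Suc n ^ 4" using self_le_power[of "Suc n" 4] by simp
    then show ?thesis unfolding r_def by (rule LeastI)
  qed
  have r_lower: "r n ^ 4 \<le> n" for n
  proof (cases "r n")
    case (Suc k)
    then have "k < (LEAST k. n < Suc k ^ 4)" by (simp add: r_def)
    then have "\<not> n < Suc k ^ 4" by (rule not_less_Least)
    with Suc show ?thesis by simp
  qed simp
  have r_top: "filterlim r at_top sequentially"
    unfolding filterlim_at_top
  proof
    fix K :: nat
    have "K \<le> r n" if "n \<ge> K ^ 4" for n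
    proof -
      have "K ^ 4 < Suc (r n) ^ 4" using r_upper[of n] that by simp
      then show ?thesis using power_less_imp_less_base[of K 4 "Suc (r n)"] by simp
    qed
    then show "\<forall>\<^sub>F n in sequentially. K \<le> r n"
      by (auto simp: eventually_sequentially)
  qed
  have close: "\<bar>A n - A m\<bar> \<le> 2 * (real n - real m) / real m" if m: "0 < m" "m \<le> n" for m n
  proof -
    have split: "(\<Sum>x<n. \<xi> x) = (\<Sum>x<m. \<xi> x) + (\<Sum>x\<in>{m..<n}. \<xi> x)"
      using m by (simp add: lessThan_atLeast0 sum.atLeastLessThan_concat)
    have "\<bar>\<Sum>x\<in>{m..<n}. \<xi> x\<bar> \<le> (\<Sum>x\<in>{m..<n}. 1)"
      using bound by (intro order.trans[OF sum_abs] sum_mono)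
    then have 1: "\<bar>\<Sum>x\<in>{m..<n}. \<xi> x\<bar> \<le> real n - real m"
      using m by (simp add: of_nat_diff)
    have 2: "\<bar>A m\<bar> \<le> 1"
      unfolding A_def using bound by (intro average_abs_le_1)
    have "A n - A m = ((\<Sum>x\<in>{m..<n}. \<xi> x) - (real n - real m) * A m) / real n"
      using m unfolding A_def split by (simp add: field_simps)
    also have "\<bar>\<dots>\<bar> \<le> ((real n - real m) + (real n - real m) * 1) / real n"
      unfolding abs_divide using 1 2 m
      by (intro frac_le order.trans[OF abs_triangle_ineq4] add_mono)
        (auto simp: abs_mult mult_left_le)
    also have "\<dots> \<le> 2 * (real n - real m) / real m"
      using m by (auto intro!: divide_left_mono)
    finally show ?thesis .
  qed
  have "(\<lambda>k. 2 * ((1 + 1 / real k) ^ 4 - 1)) \<longlonglongrightarrow> 2 * ((1 + 0) ^ 4 - 1)"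
    by (intro tendsto_intros lim_1_over_n)
  then have "(\<lambda>n. 2 * ((1 + 1 / real (r n)) ^ 4 - 1)) \<longlonglongrightarrow> 0"
    using filterlim_compose[OF _ r_top] by fastforce
  then have "(\<lambda>n. A n - A (r n ^ 4)) \<longlonglongrightarrow> 0"
  proof (rule Lim_null_comparison[rotated])
    have "\<forall>\<^sub>F n in sequentially. 1 \<le> r n"
      using r_top by (simp add: filterlim_at_top)
    then show "\<forall>\<^sub>F n in sequentially. norm (A n - A (r n ^ 4)) \<le> 2 * ((1 + 1 / real (r n)) ^ 4 - 1)"
    proof eventually_elim
      case (elim n)
      have "norm (A n - A (r n ^ 4)) \<le> 2 * (real n - real (r n ^ 4)) / real (r n ^ 4)"
        using close[of "r n ^ 4" n] r_lower[of n] elim by simp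
      also have "\<dots> \<le> 2 * (real (Suc (r n) ^ 4) - real (r n ^ 4)) / real (r n ^ 4)"
        using r_upper[of n] by (intro divide_right_mono mult_left_mono diff_mono) (auto simp del: of_nat_power)
      also have "\<dots> = 2 * ((1 + 1 / real (r n)) ^ 4 - 1)"
        using elim by (simp add: field_simps)
      finally show ?case .
    qed
  qed
  moreover have "(\<lambda>n. A (r n ^ 4)) \<longlonglongrightarrow> L"
    using filterlim_compose[OF lim r_top] by (simp add: A_def)
  ultimately have "(\<lambda>n. (A n - A (r n ^ 4)) + A (r n ^ 4)) \<longlonglongrightarrow> 0 + L"
    by (rule tendsto_add)
  then show ?thesis by (simp add: A_def)
qed

text \<open>A law of large numbers for signs whose pair correlations all agree. The averages \<open>A n\<close> satisfy \<open>E (A n - A m)\<^sup>2 = (1 - c) (1 / n - 1 / m)\<close> for \<open>n \<le> m\<close>, so the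
  increments along the fourth powers have summable first moments.\<close>

lemma (in prob_space) averages_converge_AE:
  fixes \<xi> :: "nat \<Rightarrow> 'a \<Rightarrow> real"
  assumes meas [measurable]: "\<And>x. \<xi> x \<in> borel_measurable M"
    and sign: "\<And>x \<omega>. \<omega> \<in> space M \<Longrightarrow> \<bar>\<xi> x \<omega>\<bar> = 1"
    and pair: "\<And>x y. x \<noteq> y \<Longrightarrow> expectation (\<lambda>\<omega>. \<xi> x \<omega> * \<xi> y \<omega>) = c"
  shows "AE \<omega> in M. convergent (\<lambda>n. (\<Sum>x<n. \<xi> x \<omega>) / real n)"
proof -
  define A where "A n \<omega> = (\<Sum>x<n. \<xi> x \<omega>) / real n" for n \<omega>
  have [measurable]: "A n \<in> borel_measurable M" for n
    unfolding A_def by measurable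
  have square: "\<xi> x \<omega> * \<xi> x \<omega> = 1" if "\<omega> \<in> space M" for x \<omega>
    using sign[OF that, of x] by (metis abs_mult_self_eq mult_1)
  have int: "integrable M (\<lambda>\<omega>. \<xi> x \<omega> * \<xi> y \<omega>)" for x y
    by (rule integrable_const_bound[of _ 1]) (auto simp: abs_mult sign)
  have corr: "expectation (\<lambda>\<omega>. \<xi> x \<omega> * \<xi> y \<omega>) = c + (if x = y then 1 - c else 0)" for x y
  proof (cases "x = y")
    case True
    have "expectation (\<lambda>\<omega>. \<xi> y \<omega> * \<xi> y \<omega>) = expectation (\<lambda>\<omega>. 1)"
      by (intro Bochner_Integration.integral_cong refl square)
    with True show ?thesis by (simp add: prob_space)
  qed (simp add: pair)
  have c: "-1 \<le> c"
  proof -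
    have "\<bar>c\<bar> \<le> expectation (\<lambda>\<omega>. \<bar>\<xi> 0 \<omega> * \<xi> 1 \<omega>\<bar>)"
      using pair[of 0 1] integral_abs_bound[of M "\<lambda>\<omega>. \<xi> 0 \<omega> * \<xi> 1 \<omega>"] by simp
    also have "\<dots> = expectation (\<lambda>\<omega>. 1)"
      by (intro Bochner_Integration.integral_cong) (auto simp: abs_mult sign)
    finally show ?thesis by (simp add: prob_space)
  qed
  have second_moment: "expectation (\<lambda>\<omega>. (A n \<omega> - A m \<omega>)\<^sup>2) \<le> 2 / real n"
    if nm: "0 < n" "n \<le> m" for n m
  proof -
    \<comment> \<open>the difference of the averages is \<open>\<Sum> b x * \<xi> x\<close>, with coefficients of sum zero, so that only the
      excess \<open>1 - c\<close> of the diagonal terms of its square contributes to the mean\<close>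
    define b where "b x = (if x < n then 1 / real n else 0) - 1 / real m" for x
    have mean_zero: "(\<Sum>x<m. b x) = 0" and norm: "(\<Sum>x<m. b x * b x) = 1 / real n - 1 / real m"
    proof -
      have restrict: "(\<Sum>x<m. if x < n then d else 0) = real n * d" for d :: real
      proof -
        have "(\<Sum>x<m. if x < n then d else 0) = (\<Sum>x<n. d)"
          using nm by (intro sum.mono_neutral_cong_right) auto
        then show ?thesis by simp
      qed
      show "(\<Sum>x<m. b x) = 0"
        using nm by (simp add: b_def sum_subtractf restrict)
      have "b x * b x = (if x < n then 1 / real n * (1 / real n) - 2 * (1 / real n) * (1 / real m) else 0)
          + 1 / real m * (1 / real m)" for x
        by (simp add: b_def algebra_simps)
      then have "(\<Sum>x<m. b x * b x) = real n * (1 / real n * (1 / real n) - 2 * (1 / real n) * (1 / real m))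
          + real m * (1 / real m * (1 / real m))"
        by (simp add: sum.distrib restrict)
      also have "\<dots> = 1 / real n - 1 / real m"
        using nm by (simp add: field_simps)
      finally show "(\<Sum>x<m. b x * b x) = 1 / real n - 1 / real m" .
    qed
    have diff: "A n \<omega> - A m \<omega> = (\<Sum>x<m. b x * \<xi> x \<omega>)" for \<omega>
    proof -
      have "(\<Sum>x<m. (if x < n then 1 / real n else 0) * \<xi> x \<omega>) = (\<Sum>x<n. 1 / real n * \<xi> x \<omega>)"
        using nm by (intro sum.mono_neutral_cong_right) auto
      then show ?thesis
        by (simp add: A_def b_def left_diff_distrib sum_subtractf sum_divide_distrib)
    qed
    have "expectation (\<lambda>\<omega>. (A n \<omega> - A m \<omega>)\<^sup>2)
        = expectation (\<lambda>\<omega>. \<Sum>x<m. \<Sum>y<m. b x * b y * (\<xi> x \<omega> * \<xi> y \<omega>))"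
      unfolding diff power2_eq_square sum_product by (simp add: ac_simps)
    also have "\<dots> = (\<Sum>x<m. \<Sum>y<m. b x * b y * (c + (if x = y then 1 - c else 0)))"
      using int by (simp add: Bochner_Integration.integral_sum corr)
    also have "\<dots> = (\<Sum>x<m. \<Sum>y<m. c * (b x * b y)) + (\<Sum>x<m. \<Sum>y<m. if x = y then (1 - c) * (b x * b y) else 0)"
      unfolding sum.distrib[symmetric] by (intro sum.cong refl) (simp add: algebra_simps)
    also have "(\<Sum>x<m. \<Sum>y<m. c * (b x * b y)) = c * ((\<Sum>x<m. b x) * (\<Sum>y<m. b y))"
      unfolding sum_product by (simp add: sum_distrib_left)
    also have "\<dots> = 0" by (simp add: mean_zero)
    also have "(\<Sum>x<m. \<Sum>y<m. if x = y then (1 - c) * (b x * b y) else 0) = (1 - c) * (\<Sum>x<m. b x * b x)"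
      by (simp add: sum_distrib_left)
    also have "0 + (1 - c) * (\<Sum>x<m. b x * b x) \<le> 2 * (1 / real n)"
    proof -
      have "1 / real m \<le> 1 / real n"
        using nm by (intro divide_left_mono) auto
      then have "(1 - c) * (1 / real n - 1 / real m) \<le> 2 * (1 / real n - 1 / real m)"
        using c by (intro mult_right_mono) auto
      also have "\<dots> \<le> 2 * (1 / real n)"
        by (intro mult_left_mono) auto
      finally show ?thesis by (simp only: norm add_0)
    qed
    finally show ?thesis by simp
  qed
  define D where "D k \<omega> = A (Suc (Suc k) ^ 4) \<omega> - A (Suc k ^ 4) \<omega>" for k \<omega>
  have [measurable]: "D k \<in> borel_measurable M" for k
    unfolding D_def by measurable
  have A_bound: "\<bar>A n \<omega>\<bar> \<le> 1" if "\<omega> \<in> space M" for n \<omega>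
    unfolding A_def using sign that by (intro average_abs_le_1) simp
  have D_bound: "\<bar>D k \<omega>\<bar> \<le> 2" if "\<omega> \<in> space M" for k \<omega>
    using A_bound[OF that, of "Suc (Suc k) ^ 4"] A_bound[OF that, of "Suc k ^ 4"] by (simp add: D_def)
  have int_D: "integrable M (\<lambda>\<omega>. \<bar>D k \<omega>\<bar>)" for k
    by (rule integrable_const_bound[of _ 2]) (use D_bound in auto)
  have int_D2: "integrable M (\<lambda>\<omega>. (D k \<omega>)\<^sup>2)" for k
  proof (rule integrable_const_bound[of _ "2\<^sup>2"])
    show "AE \<omega> in M. norm ((D k \<omega>)\<^sup>2) \<le> 2\<^sup>2"
      using power_mono[OF D_bound, where n = 2] by (intro AE_I2) simp
  qed simp
  have first_moment: "expectation (\<lambda>\<omega>. \<bar>D k \<omega>\<bar>) \<le> 3 / real (Suc k) ^ 2" for k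
  proof -
    define s where "s = real (Suc k) ^ 2"
    have s: "s > 0" by (simp add: s_def)
    have E2: "expectation (\<lambda>\<omega>. (D k \<omega>)\<^sup>2) \<le> 2 / s\<^sup>2"
    proof -
      have "expectation (\<lambda>\<omega>. (A (Suc k ^ 4) \<omega> - A (Suc (Suc k) ^ 4) \<omega>)\<^sup>2) \<le> 2 / real (Suc k ^ 4)"
        by (intro second_moment power_mono) auto
      then show ?thesis by (simp add: D_def s_def power2_commute power_mult[symmetric])
    qed
    \<comment> \<open>the weight \<open>s\<close> makes both terms of order \<open>1 / (k + 1)\<^sup>2\<close> in the mean\<close>
    have "\<bar>D k \<omega>\<bar> \<le> 1 / s + s * (D k \<omega>)\<^sup>2" for \<omega>
    proof -
      have "0 \<le> (s * \<bar>D k \<omega>\<bar> - 1)\<^sup>2 + s * \<bar>D k \<omega>\<bar>"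
        using s by simp
      then have "s * \<bar>D k \<omega>\<bar> \<le> 1 + s * (s * (D k \<omega>)\<^sup>2)"
        by (simp add: power2_eq_square algebra_simps)
      with s show ?thesis by (simp add: field_simps)
    qed
    then have "expectation (\<lambda>\<omega>. \<bar>D k \<omega>\<bar>) \<le> expectation (\<lambda>\<omega>. 1 / s + s * (D k \<omega>)\<^sup>2)"
      using int_D int_D2 by (intro integral_mono) auto
    also have "\<dots> = 1 / s + s * expectation (\<lambda>\<omega>. (D k \<omega>)\<^sup>2)"
      using int_D2 by (simp add: prob_space)
    also have "\<dots> \<le> 1 / s + s * (2 / s\<^sup>2)"
      using E2 s by (intro add_left_mono mult_left_mono) auto
    also have "\<dots> = 3 / s"
      using s by (simp add: power2_eq_square field_simps)
    finally show ?thesis by (simp add: s_def)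
  qed
  have "summable (\<lambda>k. 3 / real (Suc k) ^ 2)"
    using summable_mult[OF inverse_squares_sums[THEN sums_summable], of 3] by simp
  then have summable: "summable (\<lambda>k. expectation (\<lambda>\<omega>. \<bar>D k \<omega>\<bar>))"
    by (rule summable_comparison_test'[where N = 0]) (use first_moment in simp)
  have "(\<integral>\<^sup>+\<omega>. (\<Sum>k. ennreal \<bar>D k \<omega>\<bar>) \<partial>M) = (\<Sum>k. ennreal (expectation (\<lambda>\<omega>. \<bar>D k \<omega>\<bar>)))"
    by (subst nn_integral_suminf) (auto simp: nn_integral_eq_integral int_D)
  also have "\<dots> \<noteq> \<infinity>"
    unfolding infinity_ennreal_def
    by (rule ennreal_suminf_neq_top[OF summable]) (rule Bochner_Integration.integral_nonneg, simp)
  finally have "AE \<omega> in M. (\<Sum>k. ennreal \<bar>D k \<omega>\<bar>) \<noteq> \<infinity>"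
    by (intro nn_integral_PInf_AE) auto
  moreover have "AE \<omega> in M. \<omega> \<in> space M" by simp
  ultimately show ?thesis
  proof eventually_elim
    case (elim \<omega>)
    have "summable (\<lambda>k. \<bar>D k \<omega>\<bar>)"
      using elim(1) by (intro summable_suminf_not_top) auto
    then have "summable (\<lambda>k. D k \<omega>)" by (rule summable_rabs_cancel)
    then obtain S where "(\<lambda>n. \<Sum>k<n. D k \<omega>) \<longlonglongrightarrow> S"
      by (auto simp: summable_def sums_def)
    moreover have "(\<Sum>k<n. D k \<omega>) = A (Suc n ^ 4) \<omega> - A (Suc 0 ^ 4) \<omega>" for n
      unfolding D_def by (rule sum_lessThan_telescope)
    ultimately have "(\<lambda>n. (A (Suc n ^ 4) \<omega> - A (Suc 0 ^ 4) \<omega>) + A (Suc 0 ^ 4) \<omega>) \<longlonglongrightarrow> S + A (Suc 0 ^ 4) \<omega>"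
      by (intro tendsto_intros) simp
    then have "(\<lambda>n. A (n ^ 4) \<omega>) \<longlonglongrightarrow> S + A (Suc 0 ^ 4) \<omega>"
      by (intro LIMSEQ_imp_Suc[of "\<lambda>n. A (n ^ 4) \<omega>"]) simp
    then have "(\<lambda>n. A n \<omega>) \<longlonglongrightarrow> S + A (Suc 0 ^ 4) \<omega>"
      unfolding A_def using sign[OF elim(2)] by (intro averages_converge_from_fourth_powers) auto
    then show ?case unfolding A_def convergent_def by blast
  qed
qed

section \<open>Overlaps under the metastate\<close>

lemma space_spin_space: "space spin_space = UNIV \<rightarrow>\<^sub>E {-1, 1}"
  by (simp add: spin_space_def space_PiM)

lemma spin_abs: "s \<in> space spin_space \<Longrightarrow> \<bar>s x\<bar> = 1"
proof -
  assume "s \<in> space spin_space"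
  then have "s x \<in> {-1, 1}" unfolding space_spin_space by (rule PiE_mem) simp
  then show ?thesis by auto
qed

lemma spin_space_measurable [measurable]: "(\<lambda>s. s x) \<in> borel_measurable spin_space"
proof -
  have "(\<lambda>s. s x) \<in> spin_space \<rightarrow>\<^sub>M count_space {-1, 1}"
    unfolding spin_space_def by (rule measurable_component_singleton) simp
  moreover have "(\<lambda>a :: real. a) \<in> borel_measurable (count_space {-1, 1})" by simp
  ultimately show ?thesis by (rule measurable_compose)
qed

lemma replica_spin_measurable [measurable]:
  "(\<lambda>\<sigma>. \<sigma> i x) \<in> borel_measurable (Pi\<^sub>M UNIV (\<lambda>_::nat. spin_space))"
proof -
  have "(\<lambda>\<sigma>. \<sigma> i) \<in> Pi\<^sub>M UNIV (\<lambda>_::nat. spin_space) \<rightarrow>\<^sub>M spin_space"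
    by (rule measurable_component_singleton) simp
  from measurable_compose[OF this spin_space_measurable] show ?thesis .
qed

lemma fin_overlap_measurable:
  "(\<lambda>(a, b). fin_overlap n a b) \<in> borel_measurable (spin_space \<Otimes>\<^sub>M spin_space)"
  unfolding fin_overlap_def by measurable

lemma overlap_measurable:
  "(\<lambda>(a, b). overlap a b) \<in> borel_measurable (spin_space \<Otimes>\<^sub>M spin_space)"
  using fin_overlap_measurable unfolding overlap_def case_prod_beta by (rule borel_measurable_lim_metric)

text \<open>For spin configurations whose finite overlaps diverge, \<open>overlap\<close> takes a fixed default value, so
  it is bounded in any case.\<close>

lemma overlap_bounded:
  obtains B where "\<And>a b. a \<in> space spin_space \<Longrightarrow> b \<in> space spin_space \<Longrightarrow> \<bar>overlap a b\<bar> \<le> B"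
proof
  fix a b assume ab: "a \<in> space spin_space" "b \<in> space spin_space"
  show "\<bar>overlap a b\<bar> \<le> max 1 \<bar>THE L :: real. False\<bar>"
  proof (cases "convergent (\<lambda>n. fin_overlap n a b)")
    case True
    then have "(\<lambda>n. \<bar>fin_overlap n a b\<bar>) \<longlonglongrightarrow> \<bar>overlap a b\<bar>"
      unfolding overlap_def convergent_LIMSEQ_iff by (rule tendsto_rabs)
    then have "\<bar>overlap a b\<bar> \<le> 1"
      by (rule LIMSEQ_le_const2) (use ab in \<open>auto intro!: fin_overlap_abs_le_1 simp: spin_abs\<close>)
    then show ?thesis by simp
  next
    case False
    then have "overlap a b = (THE L. False)"
      unfolding overlap_def lim_def convergent_def by simp
    then show ?thesis by simp
  qed
qed

text \<open>The law of the random measure \<open>\<Gamma>\<close>.\<close>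

definition metastate_mixture ::
  "real \<Rightarrow> ((nat set \<Rightarrow> real) \<Rightarrow> (nat \<Rightarrow> real) measure measure) \<Rightarrow> (nat \<Rightarrow> real) measure measure" where
  "metastate_mixture sd \<kappa> = coupling_law sd \<bind> \<kappa>"

context
  fixes sd :: real and \<kappa> :: "(nat set \<Rightarrow> real) \<Rightarrow> (nat \<Rightarrow> real) measure measure"
  assumes sd: "sd > 0"
    and \<kappa>: "\<kappa> \<in> coupling_law sd \<rightarrow>\<^sub>M prob_algebra (prob_algebra spin_space)"
begin

lemma metastate_mixture_space:
  "metastate_mixture sd \<kappa> \<in> space (prob_algebra (prob_algebra spin_space))"
proof -
  have "coupling_law sd \<in> space (prob_algebra (coupling_law sd))"
    using prob_space_coupling_law[OF sd] by (simp add: space_prob_algebra)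
  with \<kappa> show ?thesis
    unfolding metastate_mixture_def space_prob_algebra[of "prob_algebra spin_space"]
    by (simp add: prob_space_bind' sets_bind')
qed

lemma metastate_mean_eq_mixture:
  assumes f: "f \<in> borel_measurable (Pi\<^sub>M I (\<lambda>_. spin_space))"
    and bound: "\<And>\<sigma>. \<sigma> \<in> I \<rightarrow>\<^sub>E space spin_space \<Longrightarrow> \<bar>f \<sigma>\<bar> \<le> B"
  shows "metastate_mean sd \<kappa> I (\<lambda>_. f) = (\<integral>\<Gamma>. (\<integral>\<sigma>. f \<sigma> \<partial>Pi\<^sub>M I (\<lambda>_. \<Gamma>)) \<partial>metastate_mixture sd \<kappa>)"
  unfolding metastate_mean_def metastate_mixture_def
proof (rule integral_bind_bounded[symmetric, OF prob_space_coupling_law[OF sd] \<kappa> power_integral_measurable[OF f]])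
  fix \<Gamma> assume "\<Gamma> \<in> space (prob_algebra spin_space)"
  then have \<Gamma>: "prob_space \<Gamma>" "sets \<Gamma> = sets spin_space" by (auto simp: space_prob_algebra)
  interpret P: prob_space "Pi\<^sub>M I (\<lambda>_. \<Gamma>)" by (rule prob_space_PiM) (rule \<Gamma>)
  have f': "f \<in> borel_measurable (Pi\<^sub>M I (\<lambda>_. \<Gamma>))"
    using f by (simp add: \<Gamma> cong: measurable_cong_sets sets_PiM_cong)
  have bound': "\<bar>f \<sigma>\<bar> \<le> B" if "\<sigma> \<in> space (Pi\<^sub>M I (\<lambda>_. \<Gamma>))" for \<sigma>
    using that bound sets_eq_imp_space_eq[OF \<Gamma>(2)] by (simp add: space_PiM)
  have "integrable (Pi\<^sub>M I (\<lambda>_. \<Gamma>)) f"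
    by (rule P.integrable_const_bound[of _ B]) (use bound' f' in auto)
  then have "P.expectation (\<lambda>\<sigma>. \<bar>f \<sigma>\<bar>) \<le> P.expectation (\<lambda>_. B)"
    using bound' by (intro integral_mono) auto
  then show "\<bar>P.expectation f\<bar> \<le> B"
    by (intro order.trans[OF integral_abs_bound]) (simp add: P.prob_space)
qed

lemma metastate_mean_eq_replicas:
  assumes f: "f \<in> borel_measurable (Pi\<^sub>M UNIV (\<lambda>_. spin_space))"
    and bound: "\<And>\<sigma>. \<sigma> \<in> UNIV \<rightarrow>\<^sub>E space spin_space \<Longrightarrow> \<bar>f \<sigma>\<bar> \<le> B"
  shows "metastate_mean sd \<kappa> UNIV (\<lambda>_. f) = (\<integral>\<sigma>. f \<sigma> \<partial>replicas (metastate_mixture sd \<kappa>))"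
  using metastate_mean_eq_mixture[OF f bound]
    integral_replicas[OF metastate_mixture_space f, of B] bound by simp

end

subsection \<open>Spin correlations of the metastate\<close>

text \<open>The topology of the spins of the replicas in \<open>I\<close> at the sites in \<open>L\<close>.\<close>

abbreviation spin_topology :: "nat set \<Rightarrow> nat set \<Rightarrow> (nat \<times> nat \<Rightarrow> real) topology" where
  "spin_topology I L \<equiv> product_topology (\<lambda>_. discrete_topology {-1, 1}) (I \<times> L)"

lemma continuous_map_spin:
  assumes "i \<in> I" "x \<in> L"
  shows "continuous_map (spin_topology I L) euclideanreal (\<lambda>w. w (i, x))"
proof -
  have proj: "continuous_map (spin_topology I L) (discrete_topology {-1, 1}) (\<lambda>w. w (i, x))"
    using assms by (intro continuous_map_product_projection) auto
  have incl: "continuous_map (discrete_topology {-1, 1}) euclideanreal (\<lambda>a. a)"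
    by simp
  show ?thesis
    using continuous_map_compose[OF proj incl] by (simp add: o_def)
qed

text \<open>The special case of functions of finitely many spins, without couplings.\<close>

lemma fdd_convergence_spins:
  fixes g :: "(nat \<Rightarrow> nat \<Rightarrow> real) \<Rightarrow> real"
  assumes fdd: "fdd_convergence sd \<beta> N \<kappa>" and fin: "finite I" "finite L"
    and cont: "continuous_map (spin_topology I L) euclideanreal (\<lambda>w. g (\<lambda>i x. w (i, x)))"
    and depends: "\<And>\<sigma> \<sigma>'. (\<And>i x. i \<in> I \<Longrightarrow> x \<in> L \<Longrightarrow> \<sigma> i x = \<sigma>' i x) \<Longrightarrow> g \<sigma> = g \<sigma>'"
  shows "(\<lambda>k. gibbs_mean sd \<beta> (N k) UNIV (\<lambda>_. g)) \<longlonglongrightarrow> metastate_mean sd \<kappa> UNIV (\<lambda>_. g)"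
proof -
  define f where "f p = g (\<lambda>i x. snd p (i, x))" for p :: "(nat set \<Rightarrow> real) \<times> (nat \<times> nat \<Rightarrow> real)"
  have "continuous_map (fdd_topology {} I L) euclideanreal ((\<lambda>w. g (\<lambda>i x. w (i, x))) \<circ> snd)"
    unfolding fdd_topology_def by (rule continuous_map_compose[OF continuous_map_snd cont])
  then have f: "continuous_map (fdd_topology {} I L) euclideanreal f"
    by (simp add: f_def[abs_def] o_def)
  have "finite (topspace (fdd_topology {} I L))"
    using fin by (auto simp: fdd_topology_def intro!: finite_PiE)
  then have bounded: "bounded (f ` topspace (fdd_topology {} I L))"
    by (intro finite_imp_bounded finite_imageI)
  have "(\<lambda>k. gibbs_mean sd \<beta> (N k) UNIV
        (\<lambda>J \<sigma>. f (restrict J {}, restrict (\<lambda>(i, x). \<sigma> i x) (I \<times> L))))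
      \<longlonglongrightarrow> metastate_mean sd \<kappa> UNIV
        (\<lambda>J \<sigma>. f (restrict J {}, restrict (\<lambda>(i, x). \<sigma> i x) (I \<times> L)))"
    by (rule fdd[unfolded fdd_convergence_def, rule_format]) (use f fin bounded in simp)
  moreover have "f (restrict J {}, restrict (\<lambda>(i, x). \<sigma> i x) (I \<times> L)) = g \<sigma>" for J \<sigma>
    unfolding f_def snd_conv by (rule depends) simp
  ultimately show ?thesis by simp
qed

context
  fixes sd \<beta> :: real and N :: "nat \<Rightarrow> nat"
    and \<kappa> :: "(nat set \<Rightarrow> real) \<Rightarrow> (nat \<Rightarrow> real) measure measure"
  assumes sd: "sd > 0" and N: "strict_mono N"
    and \<kappa>: "\<kappa> \<in> coupling_law sd \<rightarrow>\<^sub>M prob_algebra (prob_algebra spin_space)"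
    and fdd: "fdd_convergence sd \<beta> N \<kappa>"
begin

lemma eventually_N_ge: "\<forall>\<^sub>F k in sequentially. n \<le> N k"
  using filterlim_subseq[OF N] by (simp add: filterlim_at_top)

lemma fin_overlap_moment_limit:
  "(\<lambda>k. gibbs_mean sd \<beta> (N k) UNIV (\<lambda>_ \<sigma>. \<Prod>(i, j)\<leftarrow>l. fin_overlap n (\<sigma> i) (\<sigma> j)))
    \<longlonglongrightarrow> metastate_mean sd \<kappa> UNIV (\<lambda>_ \<sigma>. \<Prod>(i, j)\<leftarrow>l. fin_overlap n (\<sigma> i) (\<sigma> j))"
proof (rule fdd_convergence_spins[OF fdd, of "fst ` set l \<union> snd ` set l" "{..<n}"])
  have mem: "e < length l \<Longrightarrow> fst (l ! e) \<in> fst ` set l \<union> snd ` set l"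
    "e < length l \<Longrightarrow> snd (l ! e) \<in> fst ` set l \<union> snd ` set l" for e
    by auto
  show "continuous_map (spin_topology (fst ` set l \<union> snd ` set l) {..<n}) euclideanreal
      (\<lambda>w. \<Prod>(i, j)\<leftarrow>l. fin_overlap n (\<lambda>x. w (i, x)) (\<lambda>x. w (j, x)))"
    unfolding prod_list_pairs_nth fin_overlap_def divide_inverse using mem
    by (intro continuous_map_prod continuous_map_sum continuous_map_real_mult continuous_map_spin
        continuous_map_const[THEN iffD2]) auto
  fix \<sigma> \<sigma>' :: "nat \<Rightarrow> nat \<Rightarrow> real"
  assume "\<And>i x. i \<in> fst ` set l \<union> snd ` set l \<Longrightarrow> x \<in> {..<n} \<Longrightarrow> \<sigma> i x = \<sigma>' i x"
  then show "(\<Prod>(i, j)\<leftarrow>l. fin_overlap n (\<sigma> i) (\<sigma> j)) = (\<Prod>(i, j)\<leftarrow>l. fin_overlap n (\<sigma>' i) (\<sigma>' j))"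
    unfolding prod_list_pairs_nth fin_overlap_def using mem
    by (intro prod.cong refl arg_cong2[of _ _ _ _ "(/)"] sum.cong arg_cong2[of _ _ _ _ "(*)"]) auto
qed auto

lemma spin_moment_limit:
  "(\<lambda>k. gibbs_mean sd \<beta> (N k) UNIV (\<lambda>_ \<sigma>. \<Prod>e<length l. \<sigma> (fst (l ! e)) e * \<sigma> (snd (l ! e)) e))
    \<longlonglongrightarrow> metastate_mean sd \<kappa> UNIV (\<lambda>_ \<sigma>. \<Prod>e<length l. \<sigma> (fst (l ! e)) e * \<sigma> (snd (l ! e)) e)"
proof (rule fdd_convergence_spins[OF fdd, of "fst ` set l \<union> snd ` set l" "{..<length l}"])
  have mem: "e < length l \<Longrightarrow> fst (l ! e) \<in> fst ` set l \<union> snd ` set l"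
    "e < length l \<Longrightarrow> snd (l ! e) \<in> fst ` set l \<union> snd ` set l" for e
    by auto
  show "continuous_map (spin_topology (fst ` set l \<union> snd ` set l) {..<length l}) euclideanreal
      (\<lambda>w. \<Prod>e<length l. w (fst (l ! e), e) * w (snd (l ! e), e))"
    using mem by (intro continuous_map_prod continuous_map_real_mult continuous_map_spin) auto
  fix \<sigma> \<sigma>' :: "nat \<Rightarrow> nat \<Rightarrow> real"
  assume "\<And>i x. i \<in> fst ` set l \<union> snd ` set l \<Longrightarrow> x \<in> {..<length l} \<Longrightarrow> \<sigma> i x = \<sigma>' i x"
  then show "(\<Prod>e<length l. \<sigma> (fst (l ! e)) e * \<sigma> (snd (l ! e)) e) = (\<Prod>e<length l. \<sigma>' (fst (l ! e)) e * \<sigma>' (snd (l ! e)) e)"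
    using mem by (intro prod.cong refl arg_cong2[of _ _ _ _ "(*)"]) auto
qed auto

text \<open>The estimate for the Gibbs measures is uniform in the size of the system and survives the
  limit.\<close>

lemma metastate_moment_decouple:
  assumes n: "0 < n" "length l \<le> n"
  shows "\<bar>metastate_mean sd \<kappa> UNIV (\<lambda>_ \<sigma>. \<Prod>(i, j)\<leftarrow>l. fin_overlap n (\<sigma> i) (\<sigma> j)) -
      metastate_mean sd \<kappa> UNIV (\<lambda>_ \<sigma>. \<Prod>e<length l. \<sigma> (fst (l ! e)) e * \<sigma> (snd (l ! e)) e)\<bar>
    \<le> 2 * (real (length l))\<^sup>2 / real n"
  by (rule tendsto_upperbound[OF tendsto_rabs[OF tendsto_diff[OF fin_overlap_moment_limit spin_moment_limit]]])
    (use eventually_N_ge[of n] gibbs_moment_decouple[OF sd n] in \<open>auto elim: eventually_mono\<close>)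

lemma metastate_pair_moment:
  assumes "x \<noteq> y"
  shows "metastate_mean sd \<kappa> UNIV (\<lambda>_ \<sigma>. (\<sigma> i x * \<sigma> j x) * (\<sigma> i y * \<sigma> j y)) =
    metastate_mean sd \<kappa> UNIV (\<lambda>_ \<sigma>. (\<sigma> i 0 * \<sigma> j 0) * (\<sigma> i 1 * \<sigma> j 1))"
proof -
  have lim: "(\<lambda>k. gibbs_mean sd \<beta> (N k) UNIV (\<lambda>_ \<sigma>. (\<sigma> i x * \<sigma> j x) * (\<sigma> i y * \<sigma> j y)))
      \<longlonglongrightarrow> metastate_mean sd \<kappa> UNIV (\<lambda>_ \<sigma>. (\<sigma> i x * \<sigma> j x) * (\<sigma> i y * \<sigma> j y))" for x y
  proof (rule fdd_convergence_spins[OF fdd, of "{i, j}" "{x, y}"])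
    show "continuous_map (spin_topology {i, j} {x, y}) euclideanreal
        (\<lambda>w. (w (i, x) * w (j, x)) * (w (i, y) * w (j, y)))"
      by (intro continuous_map_real_mult continuous_map_spin) simp_all
  qed simp_all
  have "\<forall>\<^sub>F k in sequentially. gibbs_mean sd \<beta> (N k) UNIV (\<lambda>_ \<sigma>. (\<sigma> i x * \<sigma> j x) * (\<sigma> i y * \<sigma> j y)) =
      gibbs_mean sd \<beta> (N k) UNIV (\<lambda>_ \<sigma>. (\<sigma> i 0 * \<sigma> j 0) * (\<sigma> i 1 * \<sigma> j 1))"
    using eventually_N_ge[of "x + y + 2"]
    by eventually_elim (rule gibbs_pair_moment[OF sd], use assms in auto)
  from Lim_transform_eventually[OF lim this] lim[of 0 1] show ?thesis
    by (rule LIMSEQ_unique)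
qed

subsection \<open>Existence of the overlaps\<close>

lemma fin_overlap_convergent_AE:
  "AE \<sigma> in replicas (metastate_mixture sd \<kappa>). \<forall>i j. convergent (\<lambda>n. fin_overlap n (\<sigma> i) (\<sigma> j))"
proof -
  note mix = metastate_mixture_space[OF sd \<kappa>]
  interpret prob_space "replicas (metastate_mixture sd \<kappa>)" by (rule prob_space_replicas[OF mix])
  have spin: "\<bar>\<sigma> i x\<bar> = 1" if "\<sigma> \<in> UNIV \<rightarrow>\<^sub>E space spin_space" for \<sigma> and i x :: nat
    using that spin_abs by (auto simp: PiE_iff)
  have "AE \<sigma> in replicas (metastate_mixture sd \<kappa>). convergent (\<lambda>n. fin_overlap n (\<sigma> i) (\<sigma> j))" for i j
    unfolding fin_overlap_def
  proof (rule averages_converge_AE)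
    have meas [measurable]: "(\<lambda>\<sigma>. \<sigma> i x) \<in> borel_measurable (replicas (metastate_mixture sd \<kappa>))" for i x
      using replica_spin_measurable by (simp add: sets_replicas[OF mix] cong: measurable_cong_sets)
    show "(\<lambda>\<sigma>. \<sigma> i x * \<sigma> j x) \<in> borel_measurable (replicas (metastate_mixture sd \<kappa>))" for x
      by measurable
    show "\<bar>\<sigma> i x * \<sigma> j x\<bar> = 1" if "\<sigma> \<in> space (replicas (metastate_mixture sd \<kappa>))" for \<sigma> x
      using that spin by (simp add: space_replicas[OF mix] abs_mult)
    have E: "metastate_mean sd \<kappa> UNIV (\<lambda>_ \<sigma>. (\<sigma> i x * \<sigma> j x) * (\<sigma> i y * \<sigma> j y)) =
        expectation (\<lambda>\<sigma>. (\<sigma> i x * \<sigma> j x) * (\<sigma> i y * \<sigma> j y))" for x y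
      by (rule metastate_mean_eq_replicas[OF sd \<kappa>, where B = 1]) (auto simp: abs_mult spin)
    show "expectation (\<lambda>\<sigma>. (\<sigma> i x * \<sigma> j x) * (\<sigma> i y * \<sigma> j y)) =
        metastate_mean sd \<kappa> UNIV (\<lambda>_ \<sigma>. (\<sigma> i 0 * \<sigma> j 0) * (\<sigma> i 1 * \<sigma> j 1))" if "x \<noteq> y" for x y
      unfolding E[symmetric] by (rule metastate_pair_moment[OF that])
  qed
  then show ?thesis by (simp add: AE_all_countable)
qed

text \<open>A moment of the overlaps is a correlation of spins at distinct sites.\<close>

lemma metastate_overlap_moment:
  "(\<integral>\<sigma>. (\<Prod>(i, j)\<leftarrow>l. overlap (\<sigma> i) (\<sigma> j)) \<partial>replicas (metastate_mixture sd \<kappa>)) =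
    metastate_mean sd \<kappa> UNIV (\<lambda>_ \<sigma>. \<Prod>e<length l. \<sigma> (fst (l ! e)) e * \<sigma> (snd (l ! e)) e)"
proof -
  let ?M = "replicas (metastate_mixture sd \<kappa>)"
  let ?T = "metastate_mean sd \<kappa> UNIV (\<lambda>_ \<sigma>. \<Prod>e<length l. \<sigma> (fst (l ! e)) e * \<sigma> (snd (l ! e)) e)"
  note mix = metastate_mixture_space[OF sd \<kappa>]
  interpret prob_space ?M by (rule prob_space_replicas[OF mix])
  have bound: "\<bar>\<Prod>(i, j)\<leftarrow>l. fin_overlap n (\<sigma> i) (\<sigma> j)\<bar> \<le> 1" if "\<sigma> \<in> UNIV \<rightarrow>\<^sub>E space spin_space" for n \<sigma>
    unfolding prod_list_pairs_nth using that spin_abs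
    by (intro prod_abs_le_1 fin_overlap_abs_le_1) (auto simp: PiE_iff)
  have fin_meas: "(\<lambda>\<sigma>. \<Prod>(i, j)\<leftarrow>l. fin_overlap n (\<sigma> i) (\<sigma> j)) \<in> borel_measurable (Pi\<^sub>M UNIV (\<lambda>_. spin_space))" for n
    unfolding prod_list_pairs_nth fin_overlap_def by measurable
  have fin_meas': "(\<lambda>\<sigma>. \<Prod>(i, j)\<leftarrow>l. fin_overlap n (\<sigma> i) (\<sigma> j)) \<in> borel_measurable ?M" for n
    using fin_meas by (simp add: sets_replicas[OF mix] cong: measurable_cong_sets)
  have lim_meas: "(\<lambda>\<sigma>. overlap (\<sigma> i) (\<sigma> j)) \<in> borel_measurable (Pi\<^sub>M UNIV (\<lambda>_. spin_space))" for i j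
    by (rule measurable_compose[OF measurable_Pair overlap_measurable, unfolded prod.case]) auto
  have "(\<lambda>n. expectation (\<lambda>\<sigma>. \<Prod>(i, j)\<leftarrow>l. fin_overlap n (\<sigma> i) (\<sigma> j))) \<longlonglongrightarrow>
      expectation (\<lambda>\<sigma>. \<Prod>(i, j)\<leftarrow>l. overlap (\<sigma> i) (\<sigma> j))"
  proof (rule integral_dominated_convergence[where w = "\<lambda>_. 1"])
    show "(\<lambda>\<sigma>. \<Prod>(i, j)\<leftarrow>l. overlap (\<sigma> i) (\<sigma> j)) \<in> borel_measurable ?M"
      unfolding prod_list_pairs_nth using lim_meas
      by (intro borel_measurable_prod) (simp add: sets_replicas[OF mix] cong: measurable_cong_sets)
    show "AE \<sigma> in ?M. (\<lambda>n. \<Prod>(i, j)\<leftarrow>l. fin_overlap n (\<sigma> i) (\<sigma> j)) \<longlonglongrightarrow> (\<Prod>(i, j)\<leftarrow>l. overlap (\<sigma> i) (\<sigma> j))"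
      using fin_overlap_convergent_AE
      by eventually_elim (auto simp: prod_list_pairs_nth overlap_def convergent_LIMSEQ_iff intro!: tendsto_prod)
    show "AE \<sigma> in ?M. norm (\<Prod>(i, j)\<leftarrow>l. fin_overlap n (\<sigma> i) (\<sigma> j)) \<le> 1" for n
      using bound by (intro AE_I2) (simp add: space_replicas[OF mix])
  qed (use fin_meas' in auto)
  moreover have "(\<lambda>n. expectation (\<lambda>\<sigma>. \<Prod>(i, j)\<leftarrow>l. fin_overlap n (\<sigma> i) (\<sigma> j))) \<longlonglongrightarrow> ?T"
  proof (rule LIM_zero_cancel, rule Lim_null_comparison)
    have E: "metastate_mean sd \<kappa> UNIV (\<lambda>_ \<sigma>. \<Prod>(i, j)\<leftarrow>l. fin_overlap n (\<sigma> i) (\<sigma> j)) =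
        expectation (\<lambda>\<sigma>. \<Prod>(i, j)\<leftarrow>l. fin_overlap n (\<sigma> i) (\<sigma> j))" for n
      by (rule metastate_mean_eq_replicas[OF sd \<kappa> fin_meas bound])
    show "\<forall>\<^sub>F n in sequentially. norm (expectation (\<lambda>\<sigma>. \<Prod>(i, j)\<leftarrow>l. fin_overlap n (\<sigma> i) (\<sigma> j)) - ?T)
        \<le> 2 * (real (length l))\<^sup>2 * (1 / real n)"
      using eventually_ge_at_top[of "Suc (length l)"]
    proof eventually_elim
      case (elim n)
      then show ?case using metastate_moment_decouple[of n l] E[of n] by simp
    qed
    show "(\<lambda>n. 2 * (real (length l))\<^sup>2 * (1 / real n)) \<longlonglongrightarrow> 0"
      by (rule tendsto_mult_right_zero[OF lim_1_over_n])
  qed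
  ultimately show ?thesis by (rule LIMSEQ_unique)
qed

lemma gibbs_overlap_moment_limit:
  "(\<lambda>k. gibbs_mean sd \<beta> (N k) UNIV (\<lambda>_ \<sigma>. \<Prod>(i, j)\<leftarrow>l. fin_overlap (N k) (\<sigma> i) (\<sigma> j))) \<longlonglongrightarrow>
    (\<integral>\<sigma>. (\<Prod>(i, j)\<leftarrow>l. overlap (\<sigma> i) (\<sigma> j)) \<partial>replicas (metastate_mixture sd \<kappa>))"
proof -
  define G where "G k = gibbs_mean sd \<beta> (N k) UNIV (\<lambda>_ \<sigma>. \<Prod>(i, j)\<leftarrow>l. fin_overlap (N k) (\<sigma> i) (\<sigma> j))" for k
  define S where "S k = gibbs_mean sd \<beta> (N k) UNIV (\<lambda>_ \<sigma>. \<Prod>e<length l. \<sigma> (fst (l ! e)) e * \<sigma> (snd (l ! e)) e)" for k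
  have "(\<lambda>k. G k - S k) \<longlonglongrightarrow> 0"
  proof (rule Lim_null_comparison)
    show "\<forall>\<^sub>F k in sequentially. norm (G k - S k) \<le> 2 * (real (length l))\<^sup>2 * (1 / real (N k))"
      using eventually_N_ge[of "Suc (length l)"]
    proof eventually_elim
      case (elim k)
      then show ?case using gibbs_moment_decouple[OF sd, of "N k" l "N k" \<beta>] by (simp add: G_def S_def)
    qed
    show "(\<lambda>k. 2 * (real (length l))\<^sup>2 * (1 / real (N k))) \<longlonglongrightarrow> 0"
      by (rule tendsto_mult_right_zero[OF filterlim_compose[OF lim_1_over_n filterlim_subseq[OF N]]])
  qed
  from tendsto_add[OF this spin_moment_limit[of l, folded S_def]]
  show ?thesis by (simp add: metastate_overlap_moment G_def)
qed

end

section \<open>The overlap structures\<close>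

lemma fin_overlap_in_cov_matrices:
  assumes n: "0 < n" and spin: "\<And>i x. x < n \<Longrightarrow> \<bar>\<sigma> i x\<bar> = 1"
  shows "(\<lambda>i j. fin_overlap n (\<sigma> i) (\<sigma> j)) \<in> cov_matrices"
proof -
  have "\<sigma> i x * \<sigma> i x = 1" if "x < n" for i x
    using spin[OF that, of i] by (metis abs_mult_self_eq mult_1)
  then have "fin_overlap n (\<sigma> i) (\<sigma> i) = 1" for i
    using n by (simp add: fin_overlap_def)
  moreover have "fin_overlap n (\<sigma> i) (\<sigma> j) = fin_overlap n (\<sigma> j) (\<sigma> i)" for i j
    by (simp add: fin_overlap_def mult.commute)
  moreover have "0 \<le> (\<Sum>i<m. \<Sum>j<m. c i * c j * fin_overlap n (\<sigma> i) (\<sigma> j))" for m c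
  proof -
    have "(\<Sum>i<m. \<Sum>j<m. c i * c j * fin_overlap n (\<sigma> i) (\<sigma> j))
        = (\<Sum>i<m. \<Sum>j<m. \<Sum>x<n. (c i * \<sigma> i x) * (c j * \<sigma> j x) / real n)"
      by (simp add: fin_overlap_def sum_distrib_left sum_divide_distrib ac_simps)
    also have "\<dots> = (\<Sum>x<n. \<Sum>i<m. \<Sum>j<m. (c i * \<sigma> i x) * (c j * \<sigma> j x) / real n)"
      by (subst (2) sum.swap, subst sum.swap) simp
    also have "\<dots> = (\<Sum>x<n. (\<Sum>i<m. c i * \<sigma> i x) * (\<Sum>j<m. c j * \<sigma> j x) / real n)"
      by (simp add: sum_product sum_divide_distrib)
    also have "\<dots> \<ge> 0" by (intro sum_nonneg) simp
    finally show ?thesis .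
  qed
  ultimately show ?thesis by (auto simp: cov_matrices_def)
qed

lemma overlap_in_cov_matrices:
  assumes spin: "\<And>i x. \<bar>\<sigma> i x\<bar> = 1" and conv: "\<And>i j. convergent (\<lambda>n. fin_overlap n (\<sigma> i) (\<sigma> j))"
  shows "(\<lambda>i j. overlap (\<sigma> i) (\<sigma> j)) \<in> cov_matrices"
proof -
  have fin: "(\<lambda>i j. fin_overlap (Suc n) (\<sigma> i) (\<sigma> j)) \<in> cov_matrices" for n
    by (intro fin_overlap_in_cov_matrices) (auto simp: spin)
  have lim: "(\<lambda>n. fin_overlap (Suc n) (\<sigma> i) (\<sigma> j)) \<longlonglongrightarrow> overlap (\<sigma> i) (\<sigma> j)" for i j
    unfolding overlap_def by (rule LIMSEQ_Suc) (use conv in \<open>simp add: convergent_LIMSEQ_iff\<close>)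
  have "overlap (\<sigma> i) (\<sigma> i) = 1" for i
  proof (rule LIMSEQ_unique[OF lim])
    have "fin_overlap (Suc n) (\<sigma> i) (\<sigma> i) = 1" for n using fin[of n] by (simp add: cov_matrices_def)
    then show "(\<lambda>n. fin_overlap (Suc n) (\<sigma> i) (\<sigma> i)) \<longlonglongrightarrow> 1" by simp
  qed
  moreover have "overlap (\<sigma> i) (\<sigma> j) = overlap (\<sigma> j) (\<sigma> i)" for i j
    by (simp add: overlap_def fin_overlap_def mult.commute)
  moreover have "0 \<le> (\<Sum>i<m. \<Sum>j<m. c i * c j * overlap (\<sigma> i) (\<sigma> j))" for m c
  proof (rule LIMSEQ_le_const)
    show "(\<lambda>n. \<Sum>i<m. \<Sum>j<m. c i * c j * fin_overlap (Suc n) (\<sigma> i) (\<sigma> j)) \<longlonglongrightarrow>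
        (\<Sum>i<m. \<Sum>j<m. c i * c j * overlap (\<sigma> i) (\<sigma> j))"
      by (intro tendsto_intros lim)
    show "\<exists>n0. \<forall>n\<ge>n0. 0 \<le> (\<Sum>i<m. \<Sum>j<m. c i * c j * fin_overlap (Suc n) (\<sigma> i) (\<sigma> j))"
      using fin by (auto simp: cov_matrices_def)
  qed
  ultimately show ?thesis by (auto simp: cov_matrices_def)
qed

lemma gibbs_fin_overlap_measurable:
  "(\<lambda>(a, b). fin_overlap n a b) \<in> borel_measurable (count_space (configs N) \<Otimes>\<^sub>M count_space (configs N))"
  by (simp add: finite_configs pair_measure_countable countable_finite)

lemma is_gibbs_ROSt_iff:
  assumes sd: "sd > 0" and N: "N \<ge> 1"
  shows "is_gibbs_ROSt sd \<beta> N Q \<longleftrightarrow> ROSt Q \<and> (\<forall>s F. cylinder_fun s F \<longrightarrow> (\<integral>q. F (upper s q) \<partial>Q) =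
    (\<integral>\<sigma>. F (upper s (\<lambda>i j. fin_overlap N (\<sigma> i) (\<sigma> j))) \<partial>replicas (gibbs_mixture sd \<beta> N)))"
proof -
  have "gibbs_mean sd \<beta> N {..<s} (\<lambda>_ \<sigma>. F (upper s (\<lambda>i j. fin_overlap N (\<sigma> i) (\<sigma> j)))) =
      (\<integral>\<sigma>. F (upper s (\<lambda>i j. fin_overlap N (\<sigma> i) (\<sigma> j))) \<partial>replicas (gibbs_mixture sd \<beta> N))"
    if F: "cylinder_fun s F" for s F
  proof -
    note meas = gibbs_fin_overlap_measurable[of N N]
    have bound: "\<bar>fin_overlap N a b\<bar> \<le> 1" if "a \<in> space (count_space (configs N))" "b \<in> space (count_space (configs N))" for a b
      using that by (intro fin_overlap_abs_le_1) (auto simp: config_abs)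
    show ?thesis
      unfolding gibbs_mean_eq_mixture[OF cylinder_overlap_measurable[OF meas F order.refl]]
      by (rule integral_cylinder_replicas[OF gibbs_mixture_space[OF sd] meas bound F])
  qed
  then show ?thesis by (auto simp: is_gibbs_ROSt_def)
qed

lemma is_gibbs_ROSt_overlap_law:
  assumes sd: "sd > 0" and N: "N \<ge> 1"
  shows "is_gibbs_ROSt sd \<beta> N (overlap_law (fin_overlap N) (gibbs_mixture sd \<beta> N))"
proof -
  note mix = gibbs_mixture_space[OF sd, of \<beta> N]
  have "AE \<sigma> in replicas (gibbs_mixture sd \<beta> N). (\<lambda>i j. fin_overlap N (\<sigma> i) (\<sigma> j)) \<in> cov_matrices"
  proof (intro AE_I2 fin_overlap_in_cov_matrices)
    fix \<sigma> i x assume "\<sigma> \<in> space (replicas (gibbs_mixture sd \<beta> N))" "x < N"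
    then show "\<bar>\<sigma> i x\<bar> = 1"
      by (intro config_abs[of _ N]) (auto simp: space_replicas[OF mix] PiE_iff)
  qed (use N in simp)
  then show ?thesis
    unfolding is_gibbs_ROSt_iff[OF assms]
    by (intro conjI allI impI ROSt_overlap_law[OF mix gibbs_fin_overlap_measurable]
        integral_overlap_law[OF mix gibbs_fin_overlap_measurable])
qed

lemma is_metastate_ROSt_iff:
  assumes sd: "sd > 0" and \<kappa>: "\<kappa> \<in> coupling_law sd \<rightarrow>\<^sub>M prob_algebra (prob_algebra spin_space)"
  shows "is_metastate_ROSt sd \<kappa> Q \<longleftrightarrow> ROSt Q \<and> (\<forall>s F. cylinder_fun s F \<longrightarrow> (\<integral>q. F (upper s q) \<partial>Q) =
    (\<integral>\<sigma>. F (upper s (\<lambda>i j. overlap (\<sigma> i) (\<sigma> j))) \<partial>replicas (metastate_mixture sd \<kappa>)))"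
proof -
  have "metastate_mean sd \<kappa> {..<s} (\<lambda>_ \<sigma>. F (upper s (\<lambda>i j. overlap (\<sigma> i) (\<sigma> j)))) =
      (\<integral>\<sigma>. F (upper s (\<lambda>i j. overlap (\<sigma> i) (\<sigma> j))) \<partial>replicas (metastate_mixture sd \<kappa>))"
    if F: "cylinder_fun s F" for s F
  proof -
    obtain B where B: "\<And>a b. a \<in> space spin_space \<Longrightarrow> b \<in> space spin_space \<Longrightarrow> \<bar>overlap a b\<bar> \<le> B"
      by (rule overlap_bounded) blast
    obtain C where C: "\<And>q. (\<And>i j. i < s \<Longrightarrow> j < s \<Longrightarrow> \<bar>q i j\<bar> \<le> B) \<Longrightarrow> \<bar>F (upper s q)\<bar> \<le> C"
      by (rule cylinder_fun_bounded[OF F, where B = B]) blast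
    have "metastate_mean sd \<kappa> {..<s} (\<lambda>_ \<sigma>. F (upper s (\<lambda>i j. overlap (\<sigma> i) (\<sigma> j)))) =
        (\<integral>\<Gamma>. (\<integral>\<sigma>. F (upper s (\<lambda>i j. overlap (\<sigma> i) (\<sigma> j))) \<partial>Pi\<^sub>M {..<s} (\<lambda>_. \<Gamma>)) \<partial>metastate_mixture sd \<kappa>)"
    proof (rule metastate_mean_eq_mixture[OF sd \<kappa> cylinder_overlap_measurable[OF overlap_measurable F order.refl]])
      fix \<sigma> assume "\<sigma> \<in> {..<s} \<rightarrow>\<^sub>E space spin_space"
      then show "\<bar>F (upper s (\<lambda>i j. overlap (\<sigma> i) (\<sigma> j)))\<bar> \<le> C"
        by (intro C B) (auto simp: PiE_iff)
    qed
    also have "\<dots> = (\<integral>\<sigma>. F (upper s (\<lambda>i j. overlap (\<sigma> i) (\<sigma> j))) \<partial>replicas (metastate_mixture sd \<kappa>))"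
      by (rule integral_cylinder_replicas[OF metastate_mixture_space[OF sd \<kappa>] overlap_measurable B F])
    finally show ?thesis .
  qed
  then show ?thesis by (auto simp: is_metastate_ROSt_def)
qed

lemma is_metastate_ROSt_overlap_law:
  assumes sd: "sd > 0" and N: "strict_mono N"
    and \<kappa>: "\<kappa> \<in> coupling_law sd \<rightarrow>\<^sub>M prob_algebra (prob_algebra spin_space)"
    and fdd: "fdd_convergence sd \<beta> N \<kappa>"
  shows "is_metastate_ROSt sd \<kappa> (overlap_law overlap (metastate_mixture sd \<kappa>))"
proof -
  note mix = metastate_mixture_space[OF sd \<kappa>]
  have "AE \<sigma> in replicas (metastate_mixture sd \<kappa>). \<sigma> \<in> UNIV \<rightarrow>\<^sub>E space spin_space"
    by (rule AE_I2) (simp add: space_replicas[OF mix])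
  with fin_overlap_convergent_AE[OF assms]
  have "AE \<sigma> in replicas (metastate_mixture sd \<kappa>). (\<lambda>i j. overlap (\<sigma> i) (\<sigma> j)) \<in> cov_matrices"
    by eventually_elim (auto intro!: overlap_in_cov_matrices simp: PiE_iff spin_abs)
  then show ?thesis
    unfolding is_metastate_ROSt_iff[OF sd \<kappa>]
    by (intro conjI allI impI ROSt_overlap_law[OF mix overlap_measurable]
        integral_overlap_law[OF mix overlap_measurable])
qed

theorem proposition5p1:
  fixes sd \<beta> :: real
    and N :: "nat \<Rightarrow> nat"
    and \<kappa> :: "(nat set \<Rightarrow> real) \<Rightarrow> (nat \<Rightarrow> real) measure measure"
  assumes "sd > 0" and "\<beta> > 0"
    and "strict_mono N" and "\<And>k. N k \<ge> 1"
    and "\<kappa> \<in> coupling_law sd \<rightarrow>\<^sub>M prob_algebra (prob_algebra spin_space)"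
    and "fdd_convergence sd \<beta> N \<kappa>"
  shows "(\<forall>k. \<exists>!P. is_gibbs_ROSt sd \<beta> (N k) P) \<and>
         (\<exists>!P. is_metastate_ROSt sd \<kappa> P) \<and>
         (\<forall>Qs Q. (\<forall>k. is_gibbs_ROSt sd \<beta> (N k) (Qs k)) \<and> is_metastate_ROSt sd \<kappa> Q \<longrightarrow>
            converges_in_law Qs Q)"
proof (intro conjI allI impI)
  fix k
  have "is_gibbs_ROSt sd \<beta> (N k) (overlap_law (fin_overlap (N k)) (gibbs_mixture sd \<beta> (N k)))"
    using assms by (intro is_gibbs_ROSt_overlap_law)
  moreover have "P = P'" if "is_gibbs_ROSt sd \<beta> (N k) P" "is_gibbs_ROSt sd \<beta> (N k) P'" for P P'
    using that by (intro ROSt_eqI_cylinder) (auto simp: is_gibbs_ROSt_def)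
  ultimately show "\<exists>!P. is_gibbs_ROSt sd \<beta> (N k) P"
    by (meson ex1I)
next
  have "is_metastate_ROSt sd \<kappa> (overlap_law overlap (metastate_mixture sd \<kappa>))"
    using assms by (intro is_metastate_ROSt_overlap_law)
  moreover have "P = P'" if "is_metastate_ROSt sd \<kappa> P" "is_metastate_ROSt sd \<kappa> P'" for P P'
    using that by (intro ROSt_eqI_cylinder) (auto simp: is_metastate_ROSt_def)
  ultimately show "\<exists>!P. is_metastate_ROSt sd \<kappa> P"
    by (meson ex1I)
next
  note sd = \<open>sd > 0\<close> and N = assms(3,4) and \<kappa> = assms(5) and fdd = assms(6)
  fix Qs Q assume *: "(\<forall>k. is_gibbs_ROSt sd \<beta> (N k) (Qs k)) \<and> is_metastate_ROSt sd \<kappa> Q"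
  show "converges_in_law Qs Q"
  proof (rule converges_in_lawI_moments)
    fix l :: "(nat \<times> nat) list" assume "\<forall>(i, j)\<in>set l. i < j"
    then obtain s F where F: "cylinder_fun s F" "\<And>q. F (upper s q) = (\<Prod>(i, j)\<leftarrow>l. q i j)"
      by (rule monomial_cylinder) blast
    have "(\<integral>q. (\<Prod>(i, j)\<leftarrow>l. q i j) \<partial>Q) =
        (\<integral>\<sigma>. (\<Prod>(i, j)\<leftarrow>l. overlap (\<sigma> i) (\<sigma> j)) \<partial>replicas (metastate_mixture sd \<kappa>))"
      using * F(1) unfolding is_metastate_ROSt_iff[OF sd \<kappa>] F(2)[symmetric] by simp
    moreover have "(\<integral>q. (\<Prod>(i, j)\<leftarrow>l. q i j) \<partial>Qs k) =
        gibbs_mean sd \<beta> (N k) UNIV (\<lambda>_ \<sigma>. \<Prod>(i, j)\<leftarrow>l. fin_overlap (N k) (\<sigma> i) (\<sigma> j))" for k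
    proof -
      have "gibbs_mean sd \<beta> (N k) UNIV (\<lambda>_ \<sigma>. \<Prod>(i, j)\<leftarrow>l. fin_overlap (N k) (\<sigma> i) (\<sigma> j)) =
          (\<integral>\<sigma>. (\<Prod>(i, j)\<leftarrow>l. fin_overlap (N k) (\<sigma> i) (\<sigma> j)) \<partial>replicas (gibbs_mixture sd \<beta> (N k)))"
      proof (rule gibbs_mean_eq_replicas[OF sd])
        show "(\<lambda>\<sigma>. \<Prod>(i, j)\<leftarrow>l. fin_overlap (N k) (\<sigma> i) (\<sigma> j)) \<in>
            borel_measurable (Pi\<^sub>M UNIV (\<lambda>_. count_space (configs (N k))))"
          unfolding prod_list_pairs_nth fin_overlap_def by measurable
        show "\<bar>\<Prod>(i, j)\<leftarrow>l. fin_overlap (N k) (\<sigma> i) (\<sigma> j)\<bar> \<le> 1" if "\<sigma> \<in> UNIV \<rightarrow>\<^sub>E configs (N k)" for \<sigma>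
          unfolding prod_list_pairs_nth using that
          by (intro prod_abs_le_1 fin_overlap_abs_le_1) (auto simp: PiE_iff config_abs[of _ "N k"])
      qed
      also have "\<dots> = (\<integral>q. (\<Prod>(i, j)\<leftarrow>l. q i j) \<partial>Qs k)"
        using * F(1) unfolding is_gibbs_ROSt_iff[OF sd N(2)] F(2)[symmetric] by simp
      finally show ?thesis ..
    qed
    ultimately show "(\<lambda>k. \<integral>q. (\<Prod>(i, j)\<leftarrow>l. q i j) \<partial>Qs k) \<longlonglongrightarrow> (\<integral>q. (\<Prod>(i, j)\<leftarrow>l. q i j) \<partial>Q)"
      using gibbs_overlap_moment_limit[OF sd N(1) \<kappa> fdd, of l] by simp
  qed (use * in \<open>auto simp: is_gibbs_ROSt_def is_metastate_ROSt_def\<close>)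
qed

end
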